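(* Let $s,t$ be coprime integers greater than $1$, let $\sigma$ be an $s$-core, $\tau$ a $t$-core, and $n\ge0$. The following are equivalent: (1) There are exactly two partitions of $n$ with $s$-core $\sigma$ and $t$-core $\tau$, and they form a conjugate pair; (2) $\sigma'=\sigma$, $\tau'=\tau$, $\mathrm{cor}_t(\sigma)$ is obtained from $\mathrm{cor}_s(\tau)$ by adding or removing a rim hook, and $n=|\sigma|+s(\mathrm{wei}_s(\tau)+1)=|\tau|+t(\mathrm{wei}_t(\sigma)+1)$; (3) $\sigma'=\sigma$, $\tau'=\tau$, and $n=m_{\sigma,\tau}=|\sigma|+s(\mathrm{wei}_s(\tau)+1)=|\tau|+t(\mathrm{wei}_t(\sigma)+1)$.
   Context: Partitions, size $|\lambda|$, conjugate $\lambda'$ (reflection of the Young diagram in the main diagonal). A rim hook of $\lambda$ is a connected set of nodes of the rim of the Young diagram (nodes $(r,c)$ with $(r+1,c+1)$ not a node) whose removal leaves a partition's diagram; a rim $s$-hook is one with $s$ nodes. $\lambda$ is an $s$-core if it has no rim $s$-hook; $\mathrm{cor}_s(\lambda)$ is obtained by repeatedly removing rim $s$-hooks and $\mathrm{wei}_s(\lambda)$ is the number removed. $m_{\sigma,\tau}$ is the smallest $n$ for which there is a partition of $n$ with $s$-core $\sigma$ and $t$-core $\tau$. *)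

theory Defs
  imports Main
begin

text \<open>A partition is an infinite weakly decreasing sequence of non-negative integers with
  finite support. Rows and columns of Young diagrams are numbered from 0.\<close>

definition is_partition :: "(nat \<Rightarrow> nat) \<Rightarrow> bool" where
  "is_partition l \<longleftrightarrow> antimono l \<and> finite {r. l r \<noteq> 0}"

definition psize :: "(nat \<Rightarrow> nat) \<Rightarrow> nat" where
  "psize l = (\<Sum>r | l r \<noteq> 0. l r)"

definition diagram :: "(nat \<Rightarrow> nat) \<Rightarrow> (nat \<times> nat) set" where
  "diagram l = {(r, c). c < l r}"

text \<open>The length of row \<open>c\<close> of the conjugate is the length of column \<open>c\<close> of the diagram.\<close>

definition conjugate :: "(nat \<Rightarrow> nat) \<Rightarrow> (nat \<Rightarrow> nat)" where
  "conjugate l = (\<lambda>c. card {r. (r, c) \<in> diagram l})"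

definition rim :: "(nat \<Rightarrow> nat) \<Rightarrow> (nat \<times> nat) set" where
  "rim l = {(r, c). (r, c) \<in> diagram l \<and> (r + 1, c + 1) \<notin> diagram l}"

definition adjacent :: "nat \<times> nat \<Rightarrow> nat \<times> nat \<Rightarrow> bool" where
  "adjacent x y \<longleftrightarrow>
     (fst x = fst y \<and> (snd y = snd x + 1 \<or> snd x = snd y + 1)) \<or>
     (snd x = snd y \<and> (fst y = fst x + 1 \<or> fst x = fst y + 1))"

definition connected_nodes :: "(nat \<times> nat) set \<Rightarrow> bool" where
  "connected_nodes H \<longleftrightarrow> H \<noteq> {} \<and>
     (\<forall>x\<in>H. \<forall>y\<in>H. (\<lambda>a b. a \<in> H \<and> b \<in> H \<and> adjacent a b)\<^sup>*\<^sup>* x y)"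

definition rim_hook :: "(nat \<Rightarrow> nat) \<Rightarrow> (nat \<times> nat) set \<Rightarrow> bool" where
  "rim_hook l H \<longleftrightarrow> H \<subseteq> rim l \<and> connected_nodes H \<and>
     (\<exists>m. is_partition m \<and> diagram m = diagram l - H)"

definition removes_rim_hook :: "(nat \<Rightarrow> nat) \<Rightarrow> (nat \<Rightarrow> nat) \<Rightarrow> bool" where
  "removes_rim_hook l m \<longleftrightarrow> is_partition m \<and> (\<exists>H. rim_hook l H \<and> diagram m = diagram l - H)"

definition removes_rim_s_hook :: "nat \<Rightarrow> (nat \<Rightarrow> nat) \<Rightarrow> (nat \<Rightarrow> nat) \<Rightarrow> bool" where
  "removes_rim_s_hook s l m \<longleftrightarrow>
     is_partition m \<and> (\<exists>H. rim_hook l H \<and> card H = s \<and> diagram m = diagram l - H)"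

definition is_core :: "nat \<Rightarrow> (nat \<Rightarrow> nat) \<Rightarrow> bool" where
  "is_core s l \<longleftrightarrow> is_partition l \<and> \<not> (\<exists>H. rim_hook l H \<and> card H = s)"

text \<open>For a partition and \<open>s > 0\<close>, the core and the weight do not depend on the order in which
  the rim \<open>s\<close>-hooks are removed, so both descriptions below are satisfied uniquely.\<close>

definition cor :: "nat \<Rightarrow> (nat \<Rightarrow> nat) \<Rightarrow> (nat \<Rightarrow> nat)" where
  "cor s l = (THE m. (removes_rim_s_hook s)\<^sup>*\<^sup>* l m \<and> is_core s m)"

definition wei :: "nat \<Rightarrow> (nat \<Rightarrow> nat) \<Rightarrow> nat" where
  "wei s l = (THE k. \<exists>m. (removes_rim_s_hook s ^^ k) l m \<and> is_core s m)"

definition partitions_with_cores ::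
  "nat \<Rightarrow> nat \<Rightarrow> (nat \<Rightarrow> nat) \<Rightarrow> (nat \<Rightarrow> nat) \<Rightarrow> nat \<Rightarrow> (nat \<Rightarrow> nat) set" where
  "partitions_with_cores s t \<sigma> \<tau> n =
     {l. is_partition l \<and> psize l = n \<and> cor s l = \<sigma> \<and> cor t l = \<tau>}"

text \<open>For coprime \<open>s\<close> and \<open>t\<close>, an \<open>s\<close>-core \<open>\<sigma>\<close> and a \<open>t\<close>-core \<open>\<tau>\<close>, some \<open>n\<close> always qualifies.\<close>

definition min_size :: "nat \<Rightarrow> nat \<Rightarrow> (nat \<Rightarrow> nat) \<Rightarrow> (nat \<Rightarrow> nat) \<Rightarrow> nat" where
  "min_size s t \<sigma> \<tau> = (LEAST n. partitions_with_cores s t \<sigma> \<tau> n \<noteq> {})"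

end

theory Submission
  imports Defs
begin

text \<open>
  A partition is recorded by its set of beta numbers, a set of integers that differs from the set
  of negative integers in finitely many places. Removing a rim \<open>s\<close>-hook moves a bead from \<open>x\<close> to
  \<open>x - s\<close>, conjugation reflects and complements, and two partitions have the same \<open>s\<close>-core iff they
  have equally many beads, counted relative to the negative integers, in each class modulo \<open>s\<close>.

  Permuting the runners modulo \<open>t\<close> by shifts divisible by \<open>s\<close> preserves \<open>s\<close>-cores, acts on
  \<open>t\<close>-cores, and changes the size by an amount that depends on the \<open>t\<close>-core only. Sorting the
  runners of \<open>\<tau>\<close> turns it into its \<open>s\<close>-core \<open>K\<close>; the same with \<open>s\<close> and \<open>t\<close> exchanged turns \<open>\<sigma>\<close>
  into its \<open>t\<close>-core \<open>L\<close>. This gives a bijection from the partitions of \<open>n\<close> with cores \<open>\<sigma>\<close>, \<open>\<tau>\<close>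
  to those of some \<open>n'\<close> with cores \<open>L\<close>, \<open>K\<close>, where \<open>K\<close> and \<open>L\<close> are both \<open>s\<close>-cores and
  \<open>t\<close>-cores. The numerical condition on \<open>n\<close> says that the \<open>s\<close>-weight and the \<open>t\<close>-weight become 1.

  If both weights are 1, then \<open>K\<close> and \<open>L\<close> arise from the same bead configuration by moving one bead
  by \<open>t\<close> and by \<open>s\<close>; hence they differ by one bead, and conversely exactly two configurations exist.
  They differ by exchanging the diagonals of a rectangle \<open>z, z + s, z + t, z + s + t\<close>,
  which rules out that both are self-conjugate. If a weight is larger than 1, then
  there are at least two inversions on the \<open>s\<close>-runners; each of them is an edge of a rectangle whose
  diagonals can be exchanged, which yields at least three configurations of the same size.
\<close>

section \<open>Bead configurations\<close>

definition maya :: "int set \<Rightarrow> bool" where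
  "maya A \<longleftrightarrow> finite (A - {..<0}) \<and> finite ({..<0} - A)"

text \<open>Summation over a bead configuration, regularised by subtracting the sum over the negative
  integers. Constant weight 1 gives the charge, and weight \<open>k\<close> gives, at charge 0, the size of the
  partition.\<close>

definition wt :: "(int \<Rightarrow> int) \<Rightarrow> int set \<Rightarrow> int" where
  "wt \<phi> A = sum \<phi> (A - {..<0}) - sum \<phi> ({..<0} - A)"

abbreviation energy :: "int set \<Rightarrow> int" where
  "energy \<equiv> wt (\<lambda>k. k)"

lemma maya_finite_diff:
  assumes "maya A" and "maya B"
  shows "finite (A - B)"
proof (rule finite_subset)
  show "A - B \<subseteq> (A - {..<0}) \<union> ({..<0} - B)"
    by auto
qed (use assms in \<open>auto simp: maya_def\<close>)

lemma maya_if_finite_diff: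
  assumes "maya A" and "finite (A - B)" and "finite (B - A)"
  shows "maya B"
proof -
  have "finite (B - {..<0})"
    by (rule finite_subset[of _ "(B - A) \<union> (A - {..<0})"]) (use assms in \<open>auto simp: maya_def\<close>)
  moreover have "finite ({..<0} - B)"
    by (rule finite_subset[of _ "(A - B) \<union> ({..<0} - A)"]) (use assms in \<open>auto simp: maya_def\<close>)
  ultimately show ?thesis
    by (simp add: maya_def)
qed

text \<open>The four sums of the two regularisations and the two sums on the right range over
  subsets of one finite set \<open>F\<close>, where the identity holds position by position. Later
  computations no longer see the cut at 0.\<close>

lemma wt_diff:
  assumes "maya A" and "maya B"
  shows "wt \<phi> A - wt \<phi> B = sum \<phi> (A - B) - sum \<phi> (B - A)"
proof -
  define F where "F = (A - {..<0}) \<union> ({..<0} - A) \<union> (B - {..<0}) \<union> ({..<0} - B)"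
  have fin: "finite F"
    using assms by (auto simp: F_def maya_def)
  have restrict: "sum \<phi> X = (\<Sum>k\<in>F. if k \<in> X then \<phi> k else 0)" if "X \<subseteq> F" for X
    using that fin by (simp add: sum.inter_restrict[symmetric] Int_absorb1)
  have sub: "A - {..<0} \<subseteq> F" "{..<0} - A \<subseteq> F" "B - {..<0} \<subseteq> F" "{..<0} - B \<subseteq> F"
    "A - B \<subseteq> F" "B - A \<subseteq> F"
    by (auto simp: F_def)
  show ?thesis
    unfolding wt_def sub[THEN restrict] sum_subtractf[symmetric]
    by (rule sum.cong) auto
qed

lemma maya_bounds:
  assumes "maya A"
  obtains N where "\<And>k. k > N \<Longrightarrow> k \<notin> A" and "\<And>k. k < - N \<Longrightarrow> k \<in> A" and "N \<ge> 0"
proof -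
  have "finite ((A - {..<0}) \<union> ({..<0} - A))" (is "finite ?F")
    using assms by (simp add: maya_def)
  then obtain M where M: "\<And>k. k \<in> abs ` ?F \<Longrightarrow> k \<le> M"
    by (meson bdd_above_def bdd_above_finite finite_imageI)
  have F: "\<bar>k\<bar> \<le> M" if "k \<in> ?F" for k
    using M that by blast
  show ?thesis
  proof (rule that[of "max M 0"])
    show "k \<notin> A" if "k > max M 0" for k
      using F[of k] that by auto
    show "k \<in> A" if "k < - max M 0" for k
      using F[of k] that by (cases "k \<in> A") (auto simp: max_def split: if_splits)
  qed simp
qed

lemma maya_if_bounds:
  assumes "\<And>k. k > N \<Longrightarrow> k \<notin> A" and "\<And>k. k < M \<Longrightarrow> k \<in> A"
  shows "maya A"
proof -
  have "A - {..<0} \<subseteq> {0..N}" "{..<0} - A \<subseteq> {M..<0}"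
    using assms by force+
  then show ?thesis
    by (auto simp: maya_def intro: finite_subset)
qed

lemma energy_nonneg: "energy A \<ge> 0"
proof -
  have "(\<Sum>k\<in>A - {..<0}. k) \<ge> 0"
    by (rule sum_nonneg) auto
  moreover have "(\<Sum>k\<in>{..<0} - A. k) \<le> 0"
    by (rule sum_nonpos) auto
  ultimately show ?thesis
    by (simp add: wt_def)
qed

lemma maya_move:
  assumes "maya A"
  shows "maya (insert y (A - {x}))"
  by (rule maya_if_finite_diff[OF assms])
    (auto intro: finite_subset[of _ "{x}"] finite_subset[of _ "{y}"])

lemma wt_move:
  assumes "maya A" and "x \<in> A" and "y \<notin> A"
  shows "wt \<phi> (insert y (A - {x})) = wt \<phi> A - \<phi> x + \<phi> y"
proof -
  have "insert y (A - {x}) - A = {y}" "A - insert y (A - {x}) = {x}"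
    using assms by auto
  then show ?thesis
    using wt_diff[OF maya_move[OF assms(1)] assms(1), of \<phi> y x] by simp
qed

lemma wt_add: "wt (\<lambda>k. \<phi> k + \<psi> k) A = wt \<phi> A + wt \<psi> A"
  by (simp add: wt_def sum.distrib)

section \<open>Moves of beads and cores of configurations\<close>

text \<open>For configurations of partitions, \<open>sim s A B\<close> means that the \<open>s\<close>-cores agree.\<close>

definition sim :: "int \<Rightarrow> int set \<Rightarrow> int set \<Rightarrow> bool" where
  "sim s A B \<longleftrightarrow> (\<forall>\<phi>. (\<forall>k. \<phi> (k + s) = \<phi> k) \<longrightarrow> wt \<phi> A = wt \<phi> B)"

text \<open>Every runner modulo \<open>s\<close> is flush: the bead form of having no rim
  \<open>s\<close>-hook.\<close>

definition sclosed :: "int \<Rightarrow> int set \<Rightarrow> bool" where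
  "sclosed s A \<longleftrightarrow> (\<forall>k\<in>A. k - s \<in> A)"

definition mv :: "int \<Rightarrow> int set \<Rightarrow> int set \<Rightarrow> bool" where
  "mv s A B \<longleftrightarrow> (\<exists>x\<in>A. x - s \<notin> A \<and> B = insert (x - s) (A - {x}))"

lemma sim_refl [simp]: "sim s A A"
  and sim_sym: "sim s A B \<Longrightarrow> sim s B A"
  and sim_trans: "sim s A B \<Longrightarrow> sim s B C \<Longrightarrow> sim s A C"
  by (simp_all add: sim_def)

lemma periodic_mult:
  fixes \<phi> :: "int \<Rightarrow> 'a"
  assumes "\<And>k. \<phi> (k + s) = \<phi> k"
  shows "\<phi> (k + s * j) = \<phi> k"
proof (induction j arbitrary: k rule: int_induct[where k = 0])
  case base
  then show ?case by simp
next
  case (step1 i)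
  then show ?case
    using assms[of "k + s * i"] by (simp add: algebra_simps)
next
  case (step2 i)
  then show ?case
    using assms[of "k + s * (i - 1)"] by (simp add: algebra_simps)
qed

lemma periodic_dvd:
  fixes \<phi> :: "int \<Rightarrow> 'a"
  assumes "\<And>k. \<phi> (k + s) = \<phi> k" and "s dvd x - y"
  shows "\<phi> x = \<phi> y"
proof -
  obtain j where "x - y = s * j"
    using assms(2) by blast
  then show ?thesis
    using periodic_mult[of \<phi> s y j, OF assms(1)] by (simp add: algebra_simps)
qed

lemma sim_move:
  assumes "maya A" and "x \<in> A" and "y \<notin> A" and "s dvd x - y"
  shows "sim s (insert y (A - {x})) A"
  unfolding sim_def
proof (intro allI impI)
  fix \<phi> :: "int \<Rightarrow> int"
  assume "\<forall>k. \<phi> (k + s) = \<phi> k"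
  then have "\<phi> x = \<phi> y"
    using periodic_dvd[of \<phi> s] assms(4) by blast
  then show "wt \<phi> (insert y (A - {x})) = wt \<phi> A"
    using wt_move[OF assms(1-3), of \<phi>] by simp
qed

lemma mv_props:
  assumes "maya A" and "mv s A B"
  shows "maya B" and "sim s A B" and "energy B = energy A - s"
proof -
  obtain x where x: "x \<in> A" "x - s \<notin> A" and B: "B = insert (x - s) (A - {x})"
    using assms(2) by (auto simp: mv_def)
  show "maya B" and "energy B = energy A - s"
    using maya_move[OF assms(1)] wt_move[OF assms(1) x, of "\<lambda>k. k"] by (simp_all add: B)
  show "sim s A B"
    using sim_move[OF assms(1) x] by (simp add: B sim_sym)
qed

lemma mv_pow_props:
  assumes "maya A" and "(mv s ^^ n) A B"
  shows "maya B \<and> sim s A B \<and> energy B = energy A - s * int n"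
  using assms(2)
proof (induction n arbitrary: B)
  case 0
  then show ?case using assms(1) by simp
next
  case (Suc n)
  then obtain C where C: "(mv s ^^ n) A C" "mv s C B"
    by auto
  with Suc.IH[OF C(1)] mv_props[of C s B] show ?case
    by (auto simp: algebra_simps intro: sim_trans)
qed

lemma sclosed_or_mv: "sclosed s A \<or> (\<exists>B. mv s A B)"
  by (auto simp: sclosed_def mv_def)

text \<open>The descent terminates because each move lowers the energy by \<open>s\<close>, and
  energies are never negative.\<close>

lemma mv_to_sclosed:
  assumes "maya A" and "s > 0"
  shows "\<exists>n B. (mv s ^^ n) A B \<and> sclosed s B"
  using assms(1)
proof (induction "nat (energy A)" arbitrary: A rule: less_induct)
  case less
  show ?case
  proof (cases "sclosed s A")
    case True
    then have "(mv s ^^ 0) A A \<and> sclosed s A" by simp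
    then show ?thesis by blast
  next
    case False
    then obtain C where C: "mv s A C"
      using sclosed_or_mv by blast
    note C' = mv_props[OF less.prems C]
    have "nat (energy C) < nat (energy A)"
      using C'(3) energy_nonneg[of C] assms(2) by simp
    from less.hyps[OF this C'(1)] obtain n B where "(mv s ^^ n) C B" "sclosed s B"
      by blast
    then have "(mv s ^^ Suc n) A B \<and> sclosed s B"
      using C by (meson relpowp_Suc_I2)
    then show ?thesis by blast
  qed
qed

lemma sclosed_mult:
  assumes "sclosed s A" and "k \<in> A" and "j \<ge> 0"
  shows "k - s * j \<in> A"
  using assms(3)
proof (induction j rule: int_ge_induct)
  case base
  then show ?case using assms by simp
next
  case (step i)
  then show ?case
    using assms(1) by (force simp: sclosed_def algebra_simps)
qed

text \<open>On one runner a flush configuration is an initial segment, so any two are comparable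
  there, and equal counts force them to agree.\<close>

lemma sclosed_subset:
  assumes "maya A" and "maya B" and "sim s A B" and "sclosed s A" and "sclosed s B"
  shows "A \<subseteq> B"
proof (rule ccontr)
  assume "\<not> A \<subseteq> B"
  then obtain x where x: "x \<in> A" "x \<notin> B"
    by blast
  \<comment> \<open>The indicator of the residue class of \<open>x\<close>: testing
    \<open>sim\<close> with it compares the bead counts on this single runner.\<close>
  define \<phi> :: "int \<Rightarrow> int" where "\<phi> k = (if s dvd k - x then 1 else 0)" for k
  have "\<phi> (k + s) = \<phi> k" for k
  proof -
    have "k + s - x = (k - x) + s" by simp
    then show ?thesis
      unfolding \<phi>_def by (metis dvd_add_triv_right_iff)
  qed
  then have "wt \<phi> A = wt \<phi> B"
    using assms(3) by (simp add: sim_def)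
  then have eq: "sum \<phi> (A - B) = sum \<phi> (B - A)"
    using wt_diff[OF assms(1,2), of \<phi>] by simp
  have "\<phi> k = 0" if "k \<in> B - A" for k
  proof (rule ccontr)
    assume "\<phi> k \<noteq> 0"
    then obtain j where j: "k - x = s * j"
      by (auto simp: \<phi>_def split: if_splits)
    show False
    proof (cases "j \<ge> 0")
      case True
      have "x = k - s * j" using j by simp
      then show False
        using sclosed_mult[OF assms(5), of k j] that x True by simp
    next
      case False
      have "k = x - s * (- j)" using j by simp
      then show False
        using sclosed_mult[OF assms(4), of x "- j"] that x False by simp
    qed
  qed
  then have "sum \<phi> (B - A) = 0"
    by simp
  moreover have "sum \<phi> (A - B) \<ge> \<phi> x"
    by (rule member_le_sum) (use x maya_finite_diff[OF assms(1,2)] in \<open>auto simp: \<phi>_def\<close>)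
  ultimately show False
    using eq by (simp add: \<phi>_def)
qed

lemma sclosed_unique:
  assumes "maya A" and "maya B" and "sim s A B" and "sclosed s A" and "sclosed s B"
  shows "A = B"
  using sclosed_subset[OF assms] sclosed_subset[of B A s] assms sim_sym by blast

text \<open>Any descent ends in a flush configuration, which uniqueness identifies with
  \<open>S\<close>. The number \<open>n\<close> is the \<open>s\<close>-weight of
  \<open>A\<close>.\<close>

lemma mv_to_core:
  assumes "maya A" and "maya S" and "s > 0" and "sim s A S" and "sclosed s S"
  obtains n where "(mv s ^^ n) A S" and "energy A = energy S + s * int n"
proof -
  obtain n B where n: "(mv s ^^ n) A B" "sclosed s B"
    using mv_to_sclosed[OF assms(1,3)] by blast
  note B = mv_pow_props[OF assms(1) n(1)]
  have "B = S"
    by (rule sclosed_unique[of _ _ s]) (use B n assms in \<open>blast intro: sim_sym sim_trans\<close>)+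
  with n B show ?thesis
    by (intro that[of n]) simp_all
qed

section \<open>Permutations of runners\<close>

text \<open>The last conjunct excludes translations, which change the charge.\<close>

definition runner_perm :: "int \<Rightarrow> int \<Rightarrow> (int \<Rightarrow> int) \<Rightarrow> bool" where
  "runner_perm s t f \<longleftrightarrow> bij f \<and> (\<forall>k. f (k + t) = f k + t) \<and> (\<forall>k. s dvd f k - k) \<and>
     (\<forall>A. maya (f ` A) \<longleftrightarrow> maya A) \<and> (\<forall>A. maya A \<longrightarrow> sim s A (f ` A))"

lemma runner_perm_id: "runner_perm s t id"
  by (simp add: runner_perm_def)

lemma runner_perm_comp:
  assumes "runner_perm s t f" and "runner_perm s t g"
  shows "runner_perm s t (f \<circ> g)"
  unfolding runner_perm_def
proof (intro conjI allI impI)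
  show "bij (f \<circ> g)"
    using assms by (simp add: runner_perm_def bij_comp)
  show "s dvd (f \<circ> g) k - k" for k
  proof -
    have "s dvd (f (g k) - g k) + (g k - k)"
      by (rule dvd_add) (use assms in \<open>simp_all add: runner_perm_def\<close>)
    then show ?thesis by simp
  qed
  show "sim s A ((f \<circ> g) ` A)" if "maya A" for A
    unfolding image_comp[symmetric]
    by (rule sim_trans[of _ _ "g ` A"]) (use assms that in \<open>simp_all add: runner_perm_def\<close>)
  show "maya ((f \<circ> g) ` A) \<longleftrightarrow> maya A" for A
    using assms by (simp add: runner_perm_def image_comp[symmetric] del: comp_apply)
qed (use assms in \<open>simp_all add: runner_perm_def\<close>)

lemma runner_perm_inv:
  assumes "runner_perm s t f"
  shows "runner_perm s t (inv f)"
proof -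
  have bij: "bij f"
    using assms by (simp add: runner_perm_def)
  have f_inv: "f (inv f k) = k" for k
    using bij by (simp add: bij_is_surj surj_f_inv_f)
  have inv_f: "inv f (f k) = k" for k
    using bij by (simp add: bij_is_inj)
  have im: "f ` inv f ` A = A" for A
    by (simp add: image_image f_inv)
  have m: "maya (inv f ` A) \<longleftrightarrow> maya A" for A
    using assms im[of A] by (metis runner_perm_def)
  show ?thesis
    unfolding runner_perm_def
  proof (intro conjI allI impI)
    show "bij (inv f)"
      by (rule bij_imp_bij_inv[OF bij])
    show "inv f (k + t) = inv f k + t" for k
    proof -
      have "f (inv f k + t) = k + t"
        using assms f_inv by (simp add: runner_perm_def)
      then show ?thesis
        by (metis inv_f)
    qed
    show "s dvd inv f k - k" for k
    proof -
      have "s dvd f (inv f k) - inv f k"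
        using assms by (simp add: runner_perm_def)
      then show ?thesis
        by (simp add: f_inv dvd_diff_commute)
    qed
    show "sim s A (inv f ` A)" if "maya A" for A
      using assms m[of A] im[of A] that by (metis runner_perm_def sim_sym)
  qed (rule m)
qed

text \<open>Only differences can be transported: \<open>f\<close> need not preserve the negative
  integers, so the regularisation changes by a constant independent of the configuration.\<close>

lemma wt_image_diff:
  assumes "inj f" and "maya A" and "maya B" and "maya (f ` A)" and "maya (f ` B)"
  shows "wt \<phi> (f ` A) - wt \<phi> (f ` B) = wt (\<phi> \<circ> f) A - wt (\<phi> \<circ> f) B"
  unfolding wt_diff[OF assms(2,3)] wt_diff[OF assms(4,5)] image_set_diff[OF assms(1), symmetric]
  by (simp add: sum.reindex[OF inj_on_subset[OF assms(1)]])

lemma runner_perm_sim: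
  assumes "runner_perm s t f" and "maya A" and "maya B" and "sim t A B"
  shows "sim t (f ` A) (f ` B)"
  unfolding sim_def
proof (intro allI impI)
  fix \<phi> :: "int \<Rightarrow> int"
  assume "\<forall>k. \<phi> (k + t) = \<phi> k"
  then have "\<forall>k. (\<phi> \<circ> f) (k + t) = (\<phi> \<circ> f) k"
    using assms(1) by (simp add: runner_perm_def)
  then have "wt (\<phi> \<circ> f) A = wt (\<phi> \<circ> f) B"
    using assms(4) by (simp add: sim_def)
  moreover have "wt \<phi> (f ` A) - wt \<phi> (f ` B) = wt (\<phi> \<circ> f) A - wt (\<phi> \<circ> f) B"
    by (rule wt_image_diff) (use assms in \<open>simp_all add: runner_perm_def bij_is_inj\<close>)
  ultimately show "wt \<phi> (f ` A) = wt \<phi> (f ` B)"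
    by simp
qed

text \<open>The displacement \<open>f k - k\<close> is periodic modulo \<open>t\<close>, so its
  regularised total over a configuration depends only on the \<open>t\<close>-core.\<close>

lemma runner_perm_energy:
  assumes "runner_perm s t f" and "maya A" and "maya B" and "sim t A B"
  shows "energy (f ` A) - energy A = energy (f ` B) - energy B"
proof -
  have "energy (f ` A) - energy (f ` B) = wt ((\<lambda>k. k) \<circ> f) A - wt ((\<lambda>k. k) \<circ> f) B"
    by (rule wt_image_diff) (use assms in \<open>simp_all add: runner_perm_def bij_is_inj\<close>)
  also have "(\<lambda>k. k) \<circ> f = (\<lambda>k. k + (f k - k))"
    by auto
  also have "wt (\<lambda>k. k + (f k - k)) A - wt (\<lambda>k. k + (f k - k)) B =
      energy A - energy B + (wt (\<lambda>k. f k - k) A - wt (\<lambda>k. f k - k) B)"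
    unfolding wt_add by simp
  also have "wt (\<lambda>k. f k - k) A = wt (\<lambda>k. f k - k) B"
    using assms(1,4) by (simp add: sim_def runner_perm_def)
  finally show ?thesis
    by simp
qed

lemma runner_perm_sclosed:
  assumes "runner_perm s t f" and "sclosed t A"
  shows "sclosed t (f ` A)"
  unfolding sclosed_def
proof
  fix k
  assume "k \<in> f ` A"
  then obtain x where x: "x \<in> A" "k = f x"
    by blast
  have "f (x - t + t) = f (x - t) + t"
    using assms(1) unfolding runner_perm_def by blast
  then have "k - t = f (x - t)"
    by (simp add: x)
  then show "k - t \<in> f ` A"
    using assms(2) x by (auto simp: sclosed_def)
qed

text \<open>Exchanges the runners of \<open>x\<close> and of \<open>x + s\<close> modulo
  \<open>t\<close>. They are distinct exactly when \<open>t\<close> does not divide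
  \<open>s\<close>, and then the map is an involution.\<close>

definition runner_swap :: "int \<Rightarrow> int \<Rightarrow> int \<Rightarrow> int \<Rightarrow> int" where
  "runner_swap s t x k = (if t dvd k - x then k + s else if t dvd k - x - s then k - s else k)"

lemma runner_swap_swap:
  assumes "\<not> t dvd s"
  shows "runner_swap s t x (runner_swap s t x k) = k"
proof -
  have 1: "\<not> t dvd k + s - x" if "t dvd k - x"
  proof
    assume "t dvd k + s - x"
    then have "t dvd (k + s - x) - (k - x)" using that by (rule dvd_diff)
    then show False using assms by simp
  qed
  have 2: "k + s - x - s = k - x" "k - s - x = k - x - s" by auto
  show ?thesis
    using 1 by (auto simp: runner_swap_def 2)
qed

lemma runner_swap_image:
  assumes "\<not> t dvd s"
  shows "k \<in> runner_swap s t x ` A \<longleftrightarrow> runner_swap s t x k \<in> A"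
  using runner_swap_swap[OF assms] by (metis image_iff)

lemma runner_swap_dist: "\<bar>runner_swap s t x k - k\<bar> \<le> \<bar>s\<bar>"
  by (simp add: runner_swap_def)

lemma maya_runner_swap:
  assumes "\<not> t dvd s" and "maya A"
  shows "maya (runner_swap s t x ` A)"
proof -
  obtain N where N: "\<And>k. k > N \<Longrightarrow> k \<notin> A" "\<And>k. k < - N \<Longrightarrow> k \<in> A"
    using maya_bounds[OF assms(2)] by blast
  show ?thesis
  proof (rule maya_if_bounds[of "N + \<bar>s\<bar>" _ "- N - \<bar>s\<bar>"])
    fix k
    show "k \<notin> runner_swap s t x ` A" if "k > N + \<bar>s\<bar>"
      unfolding runner_swap_image[OF assms(1)]
      using that runner_swap_dist[of s t x k] by (intro N(1)) linarith
    show "k \<in> runner_swap s t x ` A" if "k < - N - \<bar>s\<bar>"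
      unfolding runner_swap_image[OF assms(1)]
      using that runner_swap_dist[of s t x k] by (intro N(2)) linarith
  qed
qed

text \<open>The swap is an involution, so the beads gained are the images of the beads lost.\<close>

lemma wt_runner_swap:
  assumes "\<not> t dvd s" and "maya A"
  shows "wt \<phi> (runner_swap s t x ` A) - wt \<phi> A =
    (\<Sum>k\<in>A - runner_swap s t x ` A. \<phi> (runner_swap s t x k) - \<phi> k)"
proof -
  let ?p = "runner_swap s t x"
  have inj: "inj_on ?p X" for X
    by (metis inj_onI runner_swap_swap[OF assms(1)])
  have "?p ` A - A = ?p ` (A - ?p ` A)"
    by (auto simp: runner_swap_image[OF assms(1)] runner_swap_swap[OF assms(1)])
  then have "sum \<phi> (?p ` A - A) = (\<Sum>k\<in>A - ?p ` A. \<phi> (?p k))"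
    by (simp add: sum.reindex[OF inj])
  then show ?thesis
    using wt_diff[OF maya_runner_swap[OF assms] assms(2)] by (simp add: sum_subtractf)
qed

lemma runner_perm_swap:
  assumes "\<not> t dvd s"
  shows "runner_perm s t (runner_swap s t x)"
  unfolding runner_perm_def
proof (intro conjI allI impI)
  let ?p = "runner_swap s t x"
  show "bij ?p"
    using runner_swap_swap[OF assms] by (intro o_bij[of ?p]) auto
  show "?p (k + t) = ?p k + t" for k
  proof -
    have "t dvd k + t - x \<longleftrightarrow> t dvd k - x" "t dvd k + t - x - s \<longleftrightarrow> t dvd k - x - s"
      using dvd_add_triv_right_iff[of t "k - x"] dvd_add_triv_right_iff[of t "k - x - s"]
      by (simp_all add: algebra_simps)
    then show ?thesis
      by (simp add: runner_swap_def)
  qed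
  show dvd: "s dvd ?p k - k" for k
    by (simp add: runner_swap_def)
  have "?p ` ?p ` A = A" for A
    by (simp add: image_image runner_swap_swap[OF assms])
  then show "maya (?p ` A) \<longleftrightarrow> maya A" for A
    by (metis maya_runner_swap[OF assms])
  show "sim s A (?p ` A)" if "maya A" for A
    unfolding sim_def
  proof (intro allI impI)
    fix \<phi> :: "int \<Rightarrow> int"
    assume "\<forall>k. \<phi> (k + s) = \<phi> k"
    then have "\<phi> (?p k) = \<phi> k" for k
      using periodic_dvd[of \<phi> s] dvd by blast
    then show "wt \<phi> A = wt \<phi> (?p ` A)"
      using wt_runner_swap[OF assms that, of \<phi> x] by simp
  qed
qed

text \<open>Both runners are flush, and the gap at \<open>x\<close> with the bead at
  \<open>x + s\<close> shows that the runner of \<open>x + s\<close> reaches further. Hence every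
  bead that lands on a new position moves down by \<open>s\<close>.\<close>

lemma runner_swap_decreases_energy:
  assumes "\<not> t dvd s" and "s > 0" and "maya A" and "sclosed t A" and "x \<notin> A" and "x + s \<in> A"
  shows "energy (runner_swap s t x ` A) < energy A"
proof -
  let ?p = "runner_swap s t x"
  have step: "?p k - k < 0" if "k \<in> A - ?p ` A" for k
  proof -
    have k: "k \<in> A" "?p k \<notin> A"
      using that runner_swap_image[OF assms(1)] by auto
    have "\<not> t dvd k - x"
    proof
      assume d: "t dvd k - x"
      then obtain j where j: "k - x = t * j" by blast
      have "k + s \<notin> A" using k d by (simp add: runner_swap_def)
      show False
      proof (cases "j \<ge> 0")
        case True
        have "x = k - t * j" using j by simp
        then show False
          using sclosed_mult[OF assms(4) k(1) True] assms(5) by simp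
      next
        case False
        have "x + s - t * (- j) = k + s" using j by (simp add: algebra_simps)
        then show False
          using sclosed_mult[OF assms(4,6), of "- j"] False \<open>k + s \<notin> A\<close> by (metis linear neg_0_le_iff_le)
      qed
    qed
    moreover have "?p k \<noteq> k"
      using k by auto
    ultimately show ?thesis
      using assms(2) by (auto simp: runner_swap_def split: if_splits)
  qed
  have fin: "finite (A - ?p ` A)"
    by (rule maya_finite_diff) (use assms maya_runner_swap in auto)
  have "?p (x + s) = x"
    using assms(1) by (simp add: runner_swap_def)
  then have "x + s \<in> A - ?p ` A"
    using assms by (simp add: runner_swap_image)
  then have "(\<Sum>k\<in>A - ?p ` A. ?p k - k) < (\<Sum>k\<in>A - ?p ` A. 0)"
    using step fin by (intro sum_strict_mono) auto
  then show ?thesis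
    using wt_runner_swap[OF assms(1,3), of "\<lambda>k. k" x] by simp
qed

text \<open>Bubble sort of the runners modulo \<open>t\<close>: as long as \<open>A\<close> is not
  flush modulo \<open>s\<close>, some swap lowers the energy, and flushness modulo \<open>t\<close>
  is never lost.\<close>

lemma runner_perm_sort:
  assumes "coprime s t" and "t > 1" and "s > 0" and "maya A" and "sclosed t A"
  shows "\<exists>f. runner_perm s t f \<and> sclosed s (f ` A)"
  using assms(4,5)
proof (induction "nat (energy A)" arbitrary: A rule: less_induct)
  case less
  have ts: "\<not> t dvd s"
    using assms(1,2) by (auto simp: coprime_absorb_right)
  show ?case
  proof (cases "sclosed s A")
    case True
    then have "runner_perm s t id \<and> sclosed s (id ` A)"
      by (simp add: runner_perm_id)
    then show ?thesis by blast
  next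
    case False
    then obtain y where y: "y \<in> A" "y - s \<notin> A"
      by (auto simp: sclosed_def)
    let ?p = "runner_swap s t (y - s)"
    have "energy (?p ` A) < energy A"
      by (rule runner_swap_decreases_energy[OF ts assms(3) less.prems]) (use y in simp_all)
    then have "nat (energy (?p ` A)) < nat (energy A)"
      using energy_nonneg[of "?p ` A"] by linarith
    moreover have "maya (?p ` A)"
      by (rule maya_runner_swap[OF ts less.prems(1)])
    moreover have "sclosed t (?p ` A)"
      by (rule runner_perm_sclosed[OF runner_perm_swap[OF ts] less.prems(2)])
    ultimately obtain f where f: "runner_perm s t f" "sclosed s (f ` ?p ` A)"
      using less.hyps by blast
    then have "runner_perm s t (f \<circ> ?p) \<and> sclosed s ((f \<circ> ?p) ` A)"
      using runner_perm_comp[OF f(1) runner_perm_swap[OF ts]] by (simp add: image_comp)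
    then show ?thesis by blast
  qed
qed

section \<open>Configurations with two prescribed cores\<close>

definition with_cores :: "int \<Rightarrow> int \<Rightarrow> int set \<Rightarrow> int set \<Rightarrow> int \<Rightarrow> int set set" where
  "with_cores s t S T e = {A. maya A \<and> sim s A S \<and> sim t A T \<and> energy A = e}"

lemma with_cores_commute: "with_cores s t S T e = with_cores t s T S e"
  by (auto simp: with_cores_def)

lemma with_cores_runner_perm:
  assumes "runner_perm s t f" and "maya S" and "maya T"
  shows "f ` A \<in> with_cores s t S (f ` T) (e + (energy (f ` T) - energy T)) \<longleftrightarrow>
    A \<in> with_cores s t S T e"
proof -
  have maya: "maya (f ` X) \<longleftrightarrow> maya X" and sim: "maya X \<Longrightarrow> sim s X (f ` X)" for X
    using assms(1) by (auto simp: runner_perm_def)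
  have s: "sim s (f ` A) S \<longleftrightarrow> sim s A S" if "maya A"
    using sim[OF that] by (blast intro: sim_trans sim_sym)
  have inv_im: "inv f ` f ` X = X" for X
    using assms(1) by (simp add: runner_perm_def bij_is_inj image_inv_f_f)
  have t: "sim t (f ` A) (f ` T) \<longleftrightarrow> sim t A T" if "maya A"
    using runner_perm_sim[OF assms(1) that assms(3)]
      runner_perm_sim[OF runner_perm_inv[OF assms(1)], of "f ` A" "f ` T"]
      that assms(3) by (auto simp: maya inv_im)
  show ?thesis
    using runner_perm_energy[OF assms(1) _ assms(3), of A] s t
    by (auto simp: with_cores_def maya)
qed

section \<open>Pairs of simultaneous cores\<close>

text \<open>\<open>f\<close> sorts the \<open>t\<close>-runners of \<open>T\<close> and leaves
  \<open>s\<close>-cores alone; \<open>g\<close> sorts the \<open>s\<close>-runners of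
  \<open>S\<close> and leaves \<open>t\<close>-cores alone. The last property says that rectangles
  pulled back along \<open>h\<close> still have diagonals of equal sum, which the argument about
  conjugation needs.\<close>

lemma with_cores_reduce:
  assumes "coprime s t" and "s > 1" and "t > 1"
    and "maya S" and "maya T" and "sclosed s S" and "sclosed t T"
  obtains h K L where "bij h"
    and "maya K" and "sclosed s K" and "sclosed t K" and "sim s T K"
    and "maya L" and "sclosed s L" and "sclosed t L" and "sim t S L"
    and "\<And>A e. h ` A \<in> with_cores s t L K (e + (energy K - energy T) + (energy L - energy S)) \<longleftrightarrow>
      A \<in> with_cores s t S T e"
    and "\<And>x. inv h x + inv h (x + s + t) = inv h (x + s) + inv h (x + t)"
proof -
  obtain f where f: "runner_perm s t f" and fT: "sclosed s (f ` T)"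
    using runner_perm_sort[OF assms(1,3) _ assms(5,7)] assms(2) by auto
  obtain g where g: "runner_perm t s g" and gS: "sclosed t (g ` S)"
    using runner_perm_sort[of t s S] assms by (auto simp: coprime_commute)
  have maya: "maya (f ` T)" "maya (g ` S)"
    using f g assms by (auto simp: runner_perm_def)
  have bij: "bij f" "bij g"
    using f g by (auto simp: runner_perm_def)
  show ?thesis
  proof (rule that[of "g \<circ> f" "f ` T" "g ` S"])
    show "bij (g \<circ> f)"
      using bij by (simp add: bij_comp)
    show "sclosed t (f ` T)" "sclosed s (g ` S)"
      using runner_perm_sclosed f g assms by auto
    show "sim s T (f ` T)" "sim t S (g ` S)"
      using f g assms by (auto simp: runner_perm_def)
    show "(g \<circ> f) ` A \<in> with_cores s t (g ` S) (f ` T)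
        (e + (energy (f ` T) - energy T) + (energy (g ` S) - energy S)) \<longleftrightarrow>
        A \<in> with_cores s t S T e" for A e
      unfolding image_comp[symmetric]
        with_cores_commute[of s t "g ` S"] with_cores_runner_perm[OF g maya(1) assms(4)]
        with_cores_commute[of t s _ S] with_cores_runner_perm[OF f assms(4,5)] ..
    \<comment> \<open>\<open>inv g\<close> commutes with adding \<open>s\<close> and maps
      \<open>x\<close> and \<open>x + t\<close> to the same class modulo \<open>t\<close>. There
      \<open>inv f\<close> has equal displacements, and likewise after adding \<open>s\<close>, so
      all displacements cancel.\<close>
    show "inv (g \<circ> f) x + inv (g \<circ> f) (x + s + t) = inv (g \<circ> f) (x + s) + inv (g \<circ> f) (x + t)"
      for x
    proof -
      have f': "runner_perm s t (inv f)" and g': "runner_perm t s (inv g)"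
        using f g by (simp_all add: runner_perm_inv)
      have step: "inv g (k + s) = inv g k + s" "t dvd inv g k - k" for k
        using g' by (auto simp: runner_perm_def)
      have per: "inv f (k + t) - (k + t) = inv f k - k" for k
        using f' by (simp add: runner_perm_def)
      have "t dvd (inv g (x + t) - (x + t)) - (inv g x - x) + t"
        by (intro dvd_add dvd_diff step) simp
      then have 1: "t dvd inv g (x + t) - inv g x"
        by (simp add: algebra_simps)
      then have 2: "t dvd (inv g (x + t) + s) - (inv g x + s)"
        by simp
      have "inv g (x + s + t) = inv g (x + t) + s"
        using step(1)[of "x + t"] by (simp add: add.commute add.left_commute)
      then show ?thesis
        using periodic_dvd[of "\<lambda>k. inv f k - k", OF per 1]
          periodic_dvd[of "\<lambda>k. inv f k - k", OF per 2]
        by (simp add: o_inv_distrib[OF bij(2,1)] step)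
    qed
  qed (use fT gS maya in auto)
qed

section \<open>Both weights equal to 1\<close>

lemma mv_if_energy:
  assumes "maya A" and "maya S" and "s > 0" and "sim s A S" and "sclosed s S"
    and "energy A = energy S + s"
  shows "mv s A S"
proof -
  obtain n where n: "(mv s ^^ n) A S" "energy A = energy S + s * int n"
    using mv_to_core[OF assms(1-5)] .
  have "n = 1"
    using n(2) assms(3,6) by simp
  then show ?thesis
    using n(1) by (simp add: eq_OO)
qed

text \<open>One bead of \<open>A\<close> descends by \<open>s\<close> to give \<open>L\<close> and
  one descends by \<open>t\<close> to give \<open>K\<close>. The two alternatives for
  \<open>A\<close> correspond to these being the same bead or different beads.\<close>

lemma weights_one_cases:
  assumes "s > 0" and "t > 0" and "s \<noteq> t"
    and K: "maya K" "sclosed s K" "sclosed t K" and L: "maya L" "sclosed s L"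
    and A: "A \<in> with_cores s t L K e" and e: "e = energy L + s" "e = energy K + t"
  obtains x y where "x \<in> K" and "y \<notin> K" and "L = insert y (K - {x})"
    and "A = insert (x + t) (K - {x}) \<or> A = insert y (K - {x - s})"
proof -
  have A': "maya A" "sim s A L" "sim t A K" "energy A = e"
    using A by (auto simp: with_cores_def)
  have "mv s A L" "mv t A K"
    using A' K L e assms(1,2) by (auto intro!: mv_if_energy)
  then obtain x y where x: "x \<in> A" "x - s \<notin> A" "L = insert (x - s) (A - {x})"
    and y: "y \<in> A" "y - t \<notin> A" "K = insert (y - t) (A - {y})"
    by (auto simp: mv_def)
  show ?thesis
  proof (cases "x = y")
    case True
    show ?thesis
      by (rule that[of "y - t" "x - s"]) (use x y True assms(1-3) in auto)
  next
    case False
    then have "x \<in> K" using x y by simp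
    \<comment> \<open>The position \<open>x - s\<close> is empty in \<open>A\<close> but occupied in
      \<open>K\<close>, so it must be where the other bead landed.\<close>
    then have "x - s \<in> K" using K by (simp add: sclosed_def)
    then have eq: "x - s = y - t" using x y by auto
    show ?thesis
      by (rule that[of x y]) (use x y eq False assms(1-3) in auto)
  qed
qed

text \<open>The rectangle has corners \<open>x - s\<close>, \<open>x\<close>,
  \<open>y = x - s + t\<close> and \<open>x + t\<close>. Raising \<open>x\<close> or
  \<open>x - s\<close> by \<open>t\<close> in \<open>K\<close> gives the two configurations; both
  also arise from \<open>L\<close> by raising one bead by \<open>s\<close>, which fixes the other
  core.\<close>

lemma with_cores_weights_one:
  assumes "s > 0" and "t > 0" and "s \<noteq> t"
    and K: "maya K" "sclosed s K" "sclosed t K" and L: "maya L" "sclosed s L" "sclosed t L"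
    and xy: "x \<in> K" "y \<notin> K" "L = insert y (K - {x})"
    and e: "e = energy L + s" "e = energy K + t"
  obtains z A B where "with_cores s t L K e = {A, B}"
    and "A - B = {z, z + s + t}" and "B - A = {z + s, z + t}"
proof -
  have "energy L = energy K - x + y"
    using wt_move[OF K(1) xy(1,2), of "\<lambda>k. k"] by (simp add: xy)
  then have y: "y = x - s + t"
    using e by simp
  have ne: "x \<noteq> y" using xy by auto
  have xs: "x - s \<in> K"
    using K xy by (simp add: sclosed_def)
  have xt: "x + t \<notin> K"
  proof
    assume "x + t \<in> K"
    then have "x + t - s \<in> K" using K by (simp add: sclosed_def)
    then show False using xy y by (simp add: algebra_simps)
  qed
  define A where "A = insert (x + t) (K - {x})"
  define B where "B = insert y (K - {x - s})"
  have A_alt: "A = insert (x + t) (L - {y})"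
    using xy by (auto simp: A_def)
  have B_alt: "B = insert x (L - {x - s})"
    using xy xs y assms(1-3) ne by (auto simp: B_def)
  have L': "x \<notin> L" "x + t \<notin> L" "y \<in> L" "x - s \<in> L"
    using xy ne xt xs y assms(1-3) by auto
  have "A \<in> with_cores s t L K e"
    using maya_move[OF K(1), of "x + t" x] sim_move[OF K(1) xy(1) xt, of t]
      sim_move[OF L(1) L'(3,2), of s, folded A_alt] wt_move[OF K(1) xy(1) xt, of "\<lambda>k. k"] e y
    by (simp add: with_cores_def A_def[symmetric])
  moreover have "B \<in> with_cores s t L K e"
    using maya_move[OF K(1), of y "x - s", folded B_def]
      sim_move[OF K(1) xs xy(2), of t, folded B_def] sim_move[OF L(1) L'(4,1), of s, folded B_alt]
      wt_move[OF K(1) xs xy(2), of "\<lambda>k. k", folded B_def] e y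
    by (simp add: with_cores_def)
  moreover have "C = A \<or> C = B" if C: "C \<in> with_cores s t L K e" for C
  proof -
    obtain x' y' where *: "x' \<in> K" "y' \<notin> K" "L = insert y' (K - {x'})"
      and **: "C = insert (x' + t) (K - {x'}) \<or> C = insert y' (K - {x' - s})"
      using weights_one_cases[OF assms(1-3) K L(1,2) C e] .
    \<comment> \<open>The pair is determined by \<open>K - L = {x}\<close> and
      \<open>L - K = {y}\<close>.\<close>
    have "x' = x" "y' = y"
      using xy * by auto
    then show ?thesis
      using ** by (simp add: A_def B_def)
  qed
  ultimately have "with_cores s t L K e = {A, B}"
    by blast
  moreover have "A - B = {x - s, x - s + s + t}" "B - A = {x - s + s, x - s + t}"
    using xy xs xt y assms(1-3) ne by (auto simp: A_def B_def)
  ultimately show ?thesis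
    by (rule that)
qed

section \<open>Exactly two configurations force weight 1\<close>

lemma top_bead:
  assumes "maya C" and "r > 0"
  obtains b where "b \<in> C" and "b + r \<notin> C" and "r dvd b - i"
proof -
  obtain N where N: "\<And>k. k > N \<Longrightarrow> k \<notin> C" "\<And>k. k < - N \<Longrightarrow> k \<in> C" "N \<ge> 0"
    using maya_bounds[OF assms(1)] by blast
  \<comment> \<open>Far enough that \<open>i - r * M\<close> carries a bead and
    \<open>i + r * M\<close> does not. Without a top bead, occupancy would spread from the former to
    the latter.\<close>
  define M where "M = N + \<bar>i\<bar> + 1"
  have "1 * M \<le> r * M"
    by (rule mult_right_mono) (use assms N in \<open>simp_all add: M_def\<close>)
  then have big: "i + r * M > N" "i - r * M < - N"
    using N(3) M_def by linarith+
  have "\<exists>b. b \<in> C \<and> b + r \<notin> C \<and> r dvd b - i"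
  proof (rule ccontr)
    assume no: "\<nexists>b. b \<in> C \<and> b + r \<notin> C \<and> r dvd b - i"
    have "i + r * j \<in> C" if "j \<ge> - M" for j
      using that
    proof (induction j rule: int_ge_induct)
      case base
      then show ?case using N(2) big by simp
    next
      case (step j)
      then show ?case
        using no by (force simp: algebra_simps)
    qed
    from this[of M] show False
      using N(1)[OF big(1)] N(3) by (simp add: M_def)
  qed
  then show ?thesis
    using that by blast
qed

text \<open>Otherwise a bead can be moved down by \<open>s t\<close>, and then a top bead of any of the \<open>s t \<ge> 3\<close>
  classes modulo \<open>s t\<close> can be moved up.\<close>

lemma with_cores_two_sclosed_mult:
  assumes "s > 1" and "t > 1" and Q: "with_cores s t L K e \<subseteq> {M, M'}"
    and A: "A \<in> with_cores s t L K e"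
  shows "sclosed (s * t) A"
proof (rule ccontr)
  assume "\<not> sclosed (s * t) A"
  then obtain y where y: "y \<in> A" "y - s * t \<notin> A"
    by (auto simp: sclosed_def)
  have A': "maya A" "sim s A L" "sim t A K" "energy A = e"
    using A by (auto simp: with_cores_def)
  have st: "s * t \<ge> 2 * 2"
    by (rule mult_mono) (use assms in auto)
  define C where "C = insert (y - s * t) (A - {y})"
  have C: "maya C" "sim s C A" "sim t C A" "energy C = e - s * t"
    using maya_move[OF A'(1)] sim_move[OF A'(1) y] wt_move[OF A'(1) y, of "\<lambda>k. k"] A'(4)
    by (auto simp: C_def)
  have ex: "\<exists>b. b \<in> C \<and> b + s * t \<notin> C \<and> s * t dvd b - i" for i
    using top_bead[OF C(1), of "s * t" i] st by auto
  then obtain b where b: "\<And>i. b i \<in> C" "\<And>i. b i + s * t \<notin> C" "\<And>i. s * t dvd b i - i"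
    by metis
  define D where "D i = insert (b i + s * t) (C - {b i})" for i
  have "D i \<in> with_cores s t L K e" for i
  proof -
    have "sim s (D i) C" "sim t (D i) C"
      unfolding D_def by (rule sim_move[OF C(1) b(1,2)], simp)+
    moreover have "maya (D i)" "energy (D i) = e"
      using maya_move[OF C(1)] wt_move[OF C(1) b(1,2), of "\<lambda>k. k" i i] C(4)
      by (simp_all add: D_def)
    ultimately show ?thesis
      using C A' by (auto simp: with_cores_def intro: sim_trans)
  qed
  \<comment> \<open>The residues 0, 1, 2 are distinct modulo \<open>s * t \<ge> 4\<close>, so
    \<open>D 0\<close>, \<open>D 1\<close>, \<open>D 2\<close> are three different members.\<close>
  moreover have "i = j" if "D i = D j" "0 \<le> i" "i < 3" "0 \<le> j" "j < 3" for i j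
  proof -
    have "D i - C = {b i + s * t}" for i
      using b by (auto simp: D_def)
    then have "b i = b j"
      using that(1) by (metis add_right_cancel singleton_inject)
    then have "s * t dvd b i - j"
      using b(3)[of j] by simp
    then have "s * t dvd (b i - j) - (b i - i)"
      using b(3)[of i] by (rule dvd_diff)
    then have "s * t dvd i - j" by simp
    then show ?thesis
      using that st zdvd_imp_le[of "s * t" "i - j"] zdvd_imp_le[of "s * t" "j - i"]
      by (cases i j rule: linorder_cases) (auto simp: dvd_diff_commute)
  qed
  from this[of 0 1] this[of 0 2] this[of 1 2]
  have "D 0 \<noteq> D 1" "D 0 \<noteq> D 2" "D 1 \<noteq> D 2"
    by auto
  ultimately show False
    using Q by blast
qed

lemma maya_shift:
  assumes "maya A"
  shows "maya ((\<lambda>k. k - c) ` A)"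
proof -
  obtain N where N: "\<And>k. k > N \<Longrightarrow> k \<notin> A" "\<And>k. k < - N \<Longrightarrow> k \<in> A"
    using maya_bounds[OF assms] by blast
  have im: "k \<in> (\<lambda>k. k - c) ` A \<longleftrightarrow> k + c \<in> A" for k
    by (auto intro: image_eqI[of _ _ "k + c"])
  show ?thesis
    by (rule maya_if_bounds[of "N - c" _ "- N - c"]) (use N[of "_ + c"] in \<open>auto simp: im\<close>)
qed

text \<open>Since \<open>K\<close> is an \<open>s\<close>-core, the \<open>t\<close>-runner of \<open>x\<close> holds at least as many beads as the
  \<open>t\<close>-runner of \<open>x + m s\<close>, so the inversion at \<open>x\<close> is compensated elsewhere.\<close>

lemma inversion_in_rectangle:
  assumes "maya A" and K: "maya K" "sclosed s K" and "sim t A K"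
    and x: "x \<notin> A" "x + m * s \<in> A" "m \<ge> 1"
  obtains n where "x + n * t \<in> A" and "x + m * s + n * t \<notin> A"
proof -
  have "\<exists>n. x + n * t \<in> A \<and> x + m * s + n * t \<notin> A"
  proof (rule ccontr)
    assume no: "\<nexists>n. x + n * t \<in> A \<and> x + m * s + n * t \<notin> A"
    define \<phi> :: "int \<Rightarrow> int" where "\<phi> k = (if t dvd k - x then 1 else 0)" for k
    have per: "\<phi> (k + t) = \<phi> k" for k
    proof -
      have "k + t - x = (k - x) + t" by simp
      then show ?thesis
        unfolding \<phi>_def by (metis dvd_add_triv_right_iff)
    qed
    \<comment> \<open>The shift carries the runner of \<open>x + m * s\<close> onto that of
      \<open>x\<close>. It changes the charge, so what is compared is the change of the count in
      \<open>A\<close> and in \<open>K\<close>: these agree, yet one is positive and the other is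
      not.\<close>
    let ?f = "\<lambda>k. k - m * s"
    have im: "k \<in> ?f ` X \<longleftrightarrow> k + m * s \<in> X" for k X
      by (auto intro: image_eqI[of _ _ "k + m * s"])
    have eq: "wt \<phi> A = wt \<phi> K" "wt (\<phi> \<circ> ?f) A = wt (\<phi> \<circ> ?f) K"
      using assms(4) per[of "_ - m * s"] per
      by (auto simp: sim_def algebra_simps)
    have "inj ?f" by (simp add: inj_on_def)
    then have "wt \<phi> (?f ` A) = wt \<phi> (?f ` K)"
      using wt_image_diff[of ?f A K \<phi>] eq assms(1) K(1) by (simp add: maya_shift)
    then have "wt \<phi> (?f ` A) - wt \<phi> A = wt \<phi> (?f ` K) - wt \<phi> K"
      using eq by simp
    moreover have "wt \<phi> (?f ` K) - wt \<phi> K \<le> 0"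
    proof -
      have "?f ` K \<subseteq> K"
        using sclosed_mult[OF K(2), of _ m] x(3) by (auto simp: mult.commute)
      then have empty: "?f ` K - K = {}" by blast
      show ?thesis
        unfolding wt_diff[OF maya_shift[OF K(1)] K(1)] empty
        by (simp add: \<phi>_def sum_nonneg)
    qed
    moreover have "wt \<phi> (?f ` A) - wt \<phi> A > 0"
    proof -
      have "\<phi> k = 0" if k: "k \<in> A - ?f ` A" for k
      proof (rule ccontr)
        assume "\<phi> k \<noteq> 0"
        then obtain n where "k - x = t * n"
          by (auto simp: \<phi>_def split: if_splits)
        then have "k = x + n * t" by (simp add: algebra_simps)
        then show False
          using no k by (force simp: im algebra_simps)
      qed
      then have "sum \<phi> (A - ?f ` A) = 0" by simp
      moreover have "sum \<phi> (?f ` A - A) \<ge> \<phi> x"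
      proof (rule member_le_sum)
        show "finite (?f ` A - A)"
          by (rule maya_finite_diff) (use assms(1) maya_shift in auto)
      qed (use x in \<open>auto simp: im \<phi>_def\<close>)
      ultimately show ?thesis
        unfolding wt_diff[OF maya_shift[OF assms(1)] assms(1)]
        by (simp add: \<phi>_def)
    qed
    ultimately show False by simp
  qed
  then show ?thesis
    using that by blast
qed

text \<open>That \<open>A\<close> is closed under subtracting \<open>s t\<close> makes the four corners of the rectangle distinct.\<close>

lemma rectangle_swap:
  assumes "coprime s t" and A: "A \<in> with_cores s t L K e" and "sclosed (s * t) A" and "t > 0"
    and K: "maya K" "sclosed s K" and x: "x \<notin> A" "x + m * s \<in> A" "m \<ge> 1"
  obtains B n where "B \<in> with_cores s t L K e"
    and "B - A = {x, x + m * s + n * t}" and "A - B = {x + m * s, x + n * t}" and "\<not> t dvd m * s"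
proof -
  have A': "maya A" "sim s A L" "sim t A K" "energy A = e"
    using A by (auto simp: with_cores_def)
  obtain n where n: "x + n * t \<in> A" "x + m * s + n * t \<notin> A"
    using inversion_in_rectangle[OF A'(1) K A'(3) x] .
  have "\<not> t dvd m"
  proof
    assume "t dvd m"
    then obtain j where j: "m = t * j" by blast
    have "j \<ge> 0"
      using x(3) assms(4) j by (metis zero_le_mult_iff linorder_not_le order.trans zero_le_one)
    then have "x + m * s - s * t * j \<in> A"
      by (rule sclosed_mult[OF assms(3) x(2)])
    then show False
      using x(1) j by (simp add: algebra_simps)
  qed
  then have ndvd: "\<not> t dvd m * s"
    using assms(1) by (simp add: coprime_commute coprime_dvd_mult_left_iff)
  have ne1: "x + n * t \<noteq> x + m * s"
    using ndvd by (metis add_left_cancel dvd_triv_right)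
  have ne2: "x + m * s + n * t \<noteq> x"
  proof
    assume "x + m * s + n * t = x"
    then have "m * s = t * (- n)" by (simp add: algebra_simps)
    then show False using ndvd by simp
  qed
  \<comment> \<open>The exchange is split in two ways. Through \<open>B1\<close> both beads move by
    \<open>m * s\<close>, which keeps the \<open>s\<close>-core; through \<open>B2\<close> both move
    by \<open>n * t\<close>, which keeps the \<open>t\<close>-core.\<close>
  define B1 where "B1 = insert x (A - {x + m * s})"
  define B2 where "B2 = insert x (A - {x + n * t})"
  define B where "B = insert (x + m * s + n * t) (B1 - {x + n * t})"
  have "x + n * t \<noteq> x" "x + m * s \<noteq> x" using n x by auto
  then have B_alt: "B = insert (x + m * s + n * t) (B2 - {x + m * s})"
    by (auto simp: B_def B1_def B2_def)
  have B1: "maya B1" "sim s B1 A" "energy B1 = e - m * s" "x + n * t \<in> B1" "x + m * s + n * t \<notin> B1"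
    using maya_move[OF A'(1)] sim_move[OF A'(1) x(2,1), of s] wt_move[OF A'(1) x(2,1), of "\<lambda>k. k"]
      A' n ne1 ne2 by (auto simp: B1_def)
  have B2: "maya B2" "sim t B2 A" "x + m * s \<in> B2" "x + m * s + n * t \<notin> B2"
    using maya_move[OF A'(1)] sim_move[OF A'(1) n(1) x(1), of t]
      A' n x ne1 ne2 by (auto simp: B2_def)
  have "maya B" "sim s B B1" "energy B = e"
    using maya_move[OF B1(1)] sim_move[OF B1(1,4,5), of s] wt_move[OF B1(1,4,5), of "\<lambda>k. k"] B1(3)
    by (auto simp: B_def)
  moreover have "sim t B B2"
    using sim_move[OF B2(1,3,4), of t] by (simp add: B_alt)
  ultimately have "B \<in> with_cores s t L K e"
    using B1 B2 A' by (auto simp: with_cores_def intro: sim_trans)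
  moreover have "B - A = {x, x + m * s + n * t}" "A - B = {x + m * s, x + n * t}"
    using x n ne1 ne2 \<open>x + n * t \<noteq> x\<close> \<open>x + m * s \<noteq> x\<close> by (auto simp: B_def B1_def)
  ultimately show ?thesis
    using that ndvd by blast
qed

text \<open>Each inversion yields a configuration different from \<open>A\<close>. With only two
  available these coincide, so the rectangles have the same corners.\<close>

lemma with_cores_two_inversion_unique:
  assumes "coprime s t" and "s > 1" and "t > 1" and Q: "with_cores s t L K e \<subseteq> {M, M'}"
    and A: "A \<in> with_cores s t L K e" and K: "maya K" "sclosed s K"
    and x: "x \<notin> A" "x + m * s \<in> A" "m \<ge> 1" and y: "y \<notin> A" "y + l * s \<in> A" "l \<ge> 1"
  shows "x = y \<and> m = l"
proof -
  note st = with_cores_two_sclosed_mult[OF assms(2-5)]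
  obtain B n where B: "B \<in> with_cores s t L K e" "B - A = {x, x + m * s + n * t}"
    "A - B = {x + m * s, x + n * t}" and m: "\<not> t dvd m * s"
    using rectangle_swap[OF assms(1) A st _ K x] assms(3) by auto
  obtain C i where C: "C \<in> with_cores s t L K e" "C - A = {y, y + l * s + i * t}"
    "A - C = {y + l * s, y + i * t}" and l: "\<not> t dvd l * s"
    using rectangle_swap[OF assms(1) A st _ K y] assms(3) by auto
  have "B \<noteq> A" "C \<noteq> A" using B C by auto
  then have "B = C" using Q A B(1) C(1) by blast
  then have "x = y \<or> x = y + l * s + i * t" "x + m * s = y + l * s \<or> x + m * s = y + i * t"
    using B C by auto
  \<comment> \<open>Matching the corners in any other way makes \<open>m * s\<close> a multiple of
    \<open>t\<close> or gives \<open>m\<close> and \<open>l\<close> opposite signs.\<close>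
  then consider "x = y" "m * s = l * s" | "m * s = i * t" | "m * s = - i * t"
    | "m * s = - l * s"
    by (auto simp: algebra_simps)
  then show ?thesis
  proof cases
    case 4
    then have "m = - l" using assms(2) by (metis mult_cancel_right not_one_less_zero)
    then show ?thesis using x y by simp
  qed (use m assms(2) in auto)
qed

text \<open>Here \<open>n\<close> is the common \<open>s\<close>-weight. Weight 0 would make both
  configurations equal to \<open>L\<close>, and weight at least 2 produces two inversions of
  \<open>M\<close>.\<close>

lemma with_cores_two_energy:
  assumes "coprime s t" and "s > 1" and "t > 1" and Q: "with_cores s t L K e = {M, M'}" "M \<noteq> M'"
    and K: "maya K" "sclosed s K" and L: "maya L" "sclosed s L"
  shows "e = energy L + s"
proof -
  have mem: "maya A" "sim s A L" "energy A = e" if "A \<in> {M, M'}" for A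
    using that Q(1) by (auto simp: with_cores_def)
  obtain n where n: "(mv s ^^ n) M L" "e = energy L + s * int n"
    using mv_to_core[of M L s] mem[of M] L assms(2) by auto
  obtain n' where n': "(mv s ^^ n') M' L" "e = energy L + s * int n'"
    using mv_to_core[of M' L s] mem[of M'] L assms(2) by auto
  have "n' = n" using n(2) n'(2) assms(2) by simp
  then have "n \<noteq> 0" using n n' Q(2) by (intro notI) simp
  moreover have "\<not> n \<ge> 2"
  proof
    assume "n \<ge> 2"
    obtain k where "n = Suc (Suc k)"
      using \<open>n \<ge> 2\<close> by (metis add_2_eq_Suc le_Suc_ex)
    then obtain C D where C: "mv s M C" and D: "mv s C D"
      using n(1) by (metis relpowp_Suc_D2)
    obtain x where x: "x + s \<in> M" "x \<notin> M" and C_eq: "C = insert x (M - {x + s})"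
      using C by (force simp: mv_def)
    obtain y where y: "y + s \<in> C" "y \<notin> C"
      using D by (force simp: mv_def)
    have unique: "z = x \<and> m = 1" if "z \<notin> M" "z + m * s \<in> M" "m \<ge> 1" for z m
      by (rule with_cores_two_inversion_unique[OF assms(1-3) _ _ K that, of L e M M'])
        (use x Q in auto)
    \<comment> \<open>The second move continues with the bead just moved, or fills the place it
      left, or is independent of it. The first two give an inversion of width \<open>2 * s\<close>
      in \<open>M\<close>, the third one of width \<open>s\<close> at a place other than
      \<open>x\<close>.\<close>
    consider "y + s = x" | "y = x + s" | "y \<notin> M" "y + s \<in> M"
      using y C_eq by auto
    then show False
    proof cases
      case 1
      then show False
        using unique[of y 2] y x C_eq assms(2) by (auto simp: algebra_simps)
    next
      case 2
      then show False
        using unique[of x 2] y x C_eq assms(2) by (auto simp: algebra_simps)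
    next
      case 3
      then show False
        using unique[of y 1] y C_eq by auto
    qed
  qed
  ultimately have "n = 1" by linarith
  then show ?thesis using n(2) by simp
qed

section \<open>Existence of a configuration with given cores\<close>

text \<open>Induction on the distance of \<open>B\<close> from \<open>A\<close>. Moving one bead of
  \<open>B\<close> from \<open>y\<close> to \<open>x\<close> brings it closer; the configuration
  \<open>C\<close> found for the result is repaired by moving a bead from the class of
  \<open>x\<close> to the class of \<open>y\<close> modulo \<open>s\<close> while keeping its class
  modulo \<open>t\<close>.\<close>

lemma exists_maya_sim_both:
  assumes "coprime s t" and "s > 0" and "t > 0" and "maya A" and "maya B"
    and "wt (\<lambda>_. 1) A = wt (\<lambda>_. 1) B"
  shows "\<exists>C. maya C \<and> sim s C B \<and> sim t C A"
  using assms(5,6)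
proof (induction "card (A - B)" arbitrary: B)
  case 0
  have fin: "finite (A - B)" "finite (B - A)"
    using assms(4) 0 by (auto intro: maya_finite_diff)
  have "card (B - A) = card (A - B)"
    using wt_diff[OF assms(4) 0(2), of "\<lambda>_. 1"] 0(3) by simp
  then have "A = B"
    using 0(1) fin by auto
  then show ?case
    using assms(4) by (intro exI[of _ A]) simp
next
  case (Suc n)
  have fin: "finite (A - B)" "finite (B - A)"
    using assms(4) Suc.prems by (auto intro: maya_finite_diff)
  have "card (B - A) = card (A - B)"
    using wt_diff[OF assms(4) Suc.prems(1), of "\<lambda>_. 1"] Suc.prems(2) by simp
  then have "A - B \<noteq> {}" "B - A \<noteq> {}"
    using Suc.hyps(2) by (metis card.empty nat.distinct(1))+
  then obtain x y where x: "x \<in> A" "x \<notin> B" and y: "y \<in> B" "y \<notin> A"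
    by blast
  define B' where "B' = insert x (B - {y})"
  have wtB': "wt \<phi> B' = wt \<phi> B - \<phi> y + \<phi> x" for \<phi>
    unfolding B'_def by (rule wt_move[OF Suc.prems(1) y(1) x(2)])
  have "A - B' = (A - B) - {x}"
    using x y by (auto simp: B'_def)
  then have "n = card (A - B')"
    using Suc.hyps(2) x by simp
  moreover have "maya B'"
    unfolding B'_def by (rule maya_move[OF Suc.prems(1)])
  moreover have "wt (\<lambda>_. 1) A = wt (\<lambda>_. 1) B'"
    using Suc.prems(2) by (simp add: wtB')
  ultimately obtain C where C: "maya C" "sim s C B'" "sim t C A"
    using Suc.hyps(1) by blast
  obtain z where z: "z \<in> C" "s dvd z - x"
    using top_bead[OF C(1) assms(2)] by blast
  obtain N where N: "\<And>k. k > N \<Longrightarrow> k \<notin> C"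
    using maya_bounds[OF C(1)] by blast
  obtain u v where uv: "u * s + v * t = 1"
    using bezout_int[of s t] assms(1) by auto
  \<comment> \<open>The Chinese remainder solution, congruent to \<open>y\<close> modulo
    \<open>s\<close> and to \<open>z\<close> modulo \<open>t\<close>.\<close>
  define w0 where "w0 = y + s * (u * (z - y))"
  have "w0 - z = (z - y) * (u * s + v * t) - (z - y) - t * (v * (z - y))"
    by (simp add: w0_def algebra_simps)
  then have w0: "s dvd w0 - y" "t dvd w0 - z"
    by (simp_all add: w0_def uv)
  define M where "M = \<bar>N\<bar> + \<bar>w0\<bar> + 1"
  \<comment> \<open>Adding a multiple of \<open>s * t\<close> keeps both congruences and passes
    beyond the last bead of \<open>C\<close>.\<close>
  define w where "w = w0 + s * t * M"
  have "0 < s * t"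
    using assms(2,3) by simp
  then have "1 * M \<le> s * t * M"
    by (intro mult_right_mono) (simp_all add: M_def)
  then have "w > N"
    using M_def w_def by linarith
  then have w: "w \<notin> C"
    by (rule N)
  have "s dvd (w0 - y) + s * (t * M)" "t dvd (w0 - z) + t * (s * M)"
    using w0 by (blast intro: dvd_add dvd_triv_left)+
  then have wd: "s dvd w - y" "t dvd w - z"
    by (simp_all add: w_def algebra_simps)
  define D where "D = insert w (C - {z})"
  have "maya D"
    unfolding D_def by (rule maya_move[OF C(1)])
  moreover have "sim t D A"
    unfolding D_def
    by (rule sim_trans[OF sim_move[OF C(1) z(1) w] C(3)]) (use wd in \<open>simp add: dvd_diff_commute\<close>)
  moreover have "sim s D B"
    unfolding sim_def
  proof (intro allI impI)
    fix \<phi> :: "int \<Rightarrow> int"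
    assume *: "\<forall>k. \<phi> (k + s) = \<phi> k"
    have "\<phi> w = \<phi> y" "\<phi> z = \<phi> x"
      using periodic_dvd[of \<phi> s, OF *[rule_format]] wd(1) z(2) by blast+
    moreover have "wt \<phi> C = wt \<phi> B'"
      using C(2) * unfolding sim_def by blast
    ultimately show "wt \<phi> D = wt \<phi> B"
      unfolding D_def wt_move[OF C(1) z(1) w] wtB' by simp
  qed
  ultimately show ?case
    by blast
qed

section \<open>Reflection of configurations\<close>

text \<open>Reflecting about -1/2 fixes the negative integers, the configuration of the empty
  partition.\<close>

definition reflect :: "int set \<Rightarrow> int set" where
  "reflect A = {k. - 1 - k \<notin> A}"

lemma reflect_reflect [simp]: "reflect (reflect A) = A"
  by (simp add: reflect_def)

lemma reflect_diff:
  "reflect A - {..<0} = (\<lambda>k. - 1 - k) ` ({..<0} - A)"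
  "{..<0} - reflect A = (\<lambda>k. - 1 - k) ` (A - {..<0})"
proof -
  have im: "k \<in> (\<lambda>k. - 1 - k) ` X \<longleftrightarrow> - 1 - k \<in> X" for k :: int and X
    by (auto intro: image_eqI[of _ _ "- 1 - k"])
  show "reflect A - {..<0} = (\<lambda>k. - 1 - k) ` ({..<0} - A)"
    "{..<0} - reflect A = (\<lambda>k. - 1 - k) ` (A - {..<0})"
    unfolding set_eq_iff im by (auto simp: reflect_def)
qed

lemma maya_reflect:
  assumes "maya A"
  shows "maya (reflect A)"
  using assms by (simp add: maya_def reflect_diff)

lemma wt_reflect: "wt \<phi> (reflect A) = - wt (\<lambda>k. \<phi> (- 1 - k)) A"
  unfolding wt_def reflect_diff by (simp add: sum.reindex inj_on_def)

lemma energy_reflect: "energy (reflect A) = energy A + wt (\<lambda>_. 1) A"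
  unfolding wt_reflect by (simp add: wt_def sum_subtractf sum_negf)

lemma sim_reflect:
  assumes "sim s A B"
  shows "sim s (reflect A) (reflect B)"
  unfolding sim_def wt_reflect
proof (intro allI impI)
  fix \<phi> :: "int \<Rightarrow> int"
  assume per: "\<forall>k. \<phi> (k + s) = \<phi> k"
  have "\<phi> (- 1 - (k + s)) = \<phi> (- 1 - k)" for k
    using per[rule_format, of "- 1 - (k + s)"] by (simp add: algebra_simps)
  then show "- wt (\<lambda>k. \<phi> (- 1 - k)) A = - wt (\<lambda>k. \<phi> (- 1 - k)) B"
    using assms by (simp add: sim_def)
qed

lemma sclosed_reflect:
  assumes "sclosed s A"
  shows "sclosed s (reflect A)"
  unfolding sclosed_def reflect_def
proof clarsimp
  fix k
  assume k: "- 1 - k \<notin> A" and "- 1 - (k - s) \<in> A"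
  then have "- 1 - (k - s) - s \<in> A"
    using assms unfolding sclosed_def by blast
  then show False
    using k by simp
qed

section \<open>Beta numbers of partitions\<close>

definition beta :: "(nat \<Rightarrow> nat) \<Rightarrow> int set" where
  "beta l = range (\<lambda>r. int (l r) - int r - 1)"

lemma beta_less:
  assumes "antimono l" and "r < q"
  shows "int (l q) - int q - 1 < int (l r) - int r - 1"
  using antimonoD[OF assms(1), of r q] assms(2) by simp

lemma beta_eq_iff:
  assumes "antimono l"
  shows "int (l q) - int q - 1 = int (l r) - int r - 1 \<longleftrightarrow> q = r"
  using beta_less[OF assms, of q r] beta_less[OF assms, of r q]
  by (cases q r rule: linorder_cases) auto

text \<open>The enumeration by rows is strictly decreasing, so its range determines it: at the first
  row where two such enumerations differ, the larger value is missed by the other one.\<close>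

lemma beta_inj:
  assumes "antimono l" and "antimono m" and "beta l = beta m"
  shows "l = m"
proof
  fix r
  show "l r = m r"
  proof (induction r rule: less_induct)
    case (less r)
    have *: "\<not> k r < j r"
      if kj: "antimono k" "antimono j" "beta k = beta j" "\<And>q. q < r \<Longrightarrow> k q = j q"
      for k j :: "nat \<Rightarrow> nat"
    proof
      assume lt: "k r < j r"
      have "int (j r) - int r - 1 \<in> beta k"
        unfolding kj(3) by (simp add: beta_def)
      then obtain q where q: "int (j r) - int r - 1 = int (k q) - int q - 1"
        by (auto simp: beta_def)
      then have "q < r"
        using lt beta_less[OF kj(1), of r q] by (cases q r rule: linorder_cases) auto
      then show False
        using q kj(4)[of q] beta_less[OF kj(2), of q r] by simp
    qed
    show ?case
      using *[OF assms less] *[OF assms(2,1) assms(3)[symmetric] less[symmetric]] by simp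
  qed
qed

lemma partition_bound:
  assumes "is_partition l"
  obtains N where "\<And>r. r \<ge> N \<Longrightarrow> l r = 0"
proof -
  have "finite {r. l r \<noteq> 0}"
    using assms by (simp add: is_partition_def)
  then obtain N where "\<forall>r\<in>{r. l r \<noteq> 0}. r < N"
    using finite_nat_set_iff_bounded by blast
  then show ?thesis
    using that[of N] by force
qed

text \<open>From row \<open>N\<close> on, beads sit where the empty partition has them. The formula
  pairs the bead of each earlier row with its position \<open>- int r - 1\<close> for the empty
  partition.\<close>

lemma wt_beta_bound:
  assumes "antimono l" and N: "\<And>r. r \<ge> N \<Longrightarrow> l r = 0"
  shows "maya (beta l)"
    and "wt \<phi> (beta l) = (\<Sum>r<N. \<phi> (int (l r) - int r - 1) - \<phi> (- int r - 1))"
proof -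
  let ?b = "\<lambda>r. int (l r) - int r - 1" and ?c = "\<lambda>r. - int r - 1"
  define X where "X = ?b ` {..<N}"
  define Y where "Y = ?c ` {..<N}"
  have Y: "k \<in> Y \<longleftrightarrow> - int N \<le> k \<and> k < 0" for k
    by (auto simp: Y_def intro!: image_eqI[of _ _ "nat (- k - 1)"])
  have "k \<in> beta l \<longleftrightarrow> k \<in> X \<or> k < - int N" for k
  proof
    assume "k \<in> beta l"
    then obtain r where "k = ?b r"
      by (auto simp: beta_def)
    then show "k \<in> X \<or> k < - int N"
      using N[of r] by (cases "r < N") (auto simp: X_def)
  next
    assume "k \<in> X \<or> k < - int N"
    moreover have "k = ?b (nat (- k - 1))" if "k < - int N"
      using N[of "nat (- k - 1)"] that by simp
    ultimately show "k \<in> beta l"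
      unfolding beta_def X_def by blast
  qed
  then have beta: "beta l = X \<union> {..< - int N}"
    by auto
  have X: "- int N \<le> k" if "k \<in> X" for k
    using that by (auto simp: X_def)
  have fin: "finite X" "finite Y"
    by (simp_all add: X_def Y_def)
  have diff: "beta l - {..<0} = X - Y" "{..<0} - beta l = Y - X"
    using X by (auto simp: beta Y)
  then show "maya (beta l)"
    using fin by (simp add: maya_def)
  have "sum \<phi> X = sum \<phi> (X - Y) + sum \<phi> (X \<inter> Y)" "sum \<phi> Y = sum \<phi> (Y - X) + sum \<phi> (X \<inter> Y)"
    using sum.Int_Diff[OF fin(1), of \<phi> Y] sum.Int_Diff[OF fin(2), of \<phi> X]
    by (simp_all add: Int_commute)
  then have "wt \<phi> (beta l) = sum \<phi> X - sum \<phi> Y"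
    by (simp add: wt_def diff)
  also have "sum \<phi> X = (\<Sum>r<N. \<phi> (?b r))"
    unfolding X_def by (subst sum.reindex) (auto simp: inj_on_def beta_eq_iff[OF assms(1)])
  also have "sum \<phi> Y = (\<Sum>r<N. \<phi> (?c r))"
    unfolding Y_def by (subst sum.reindex) (auto simp: inj_on_def)
  finally show "wt \<phi> (beta l) = (\<Sum>r<N. \<phi> (?b r) - \<phi> (?c r))"
    by (simp add: sum_subtractf)
qed

lemma wt_beta:
  assumes "is_partition l"
  shows maya_beta: "maya (beta l)" and energy_beta: "energy (beta l) = int (psize l)"
    and charge_beta: "wt (\<lambda>_. 1) (beta l) = 0"
proof -
  obtain N where N: "\<And>r. r \<ge> N \<Longrightarrow> l r = 0"
    using partition_bound[OF assms] by blast
  have l: "antimono l"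
    using assms by (simp add: is_partition_def)
  show "maya (beta l)"
    by (rule wt_beta_bound[OF l N])
  have "{r. l r \<noteq> 0} \<subseteq> {..<N}"
    using N by (force simp: not_le)
  then have "psize l = (\<Sum>r<N. l r)"
    unfolding psize_def by (intro sum.mono_neutral_left) auto
  then show "energy (beta l) = int (psize l)"
    by (simp add: wt_beta_bound(2)[OF l N])
  show "wt (\<lambda>_. 1) (beta l) = 0"
    by (simp add: wt_beta_bound(2)[OF l N])
qed

lemma beta_add_node:
  assumes "is_partition m" and "x - 1 \<in> beta m" and "x \<notin> beta m"
  shows "\<exists>l. is_partition l \<and> beta l = insert x (beta m - {x - 1})"
proof -
  obtain r where r: "x - 1 = int (m r) - int r - 1"
    using assms(2) by (auto simp: beta_def)
  have m: "antimono m"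
    using assms(1) by (simp add: is_partition_def)
  define l where "l = m(r := m r + 1)"
  \<comment> \<open>The position just above the bead of row \<open>r\<close> is free, so the
    preceding row is strictly longer and the new node fits.\<close>
  have gt: "m r < m p" if "p < r" for p
  proof -
    have "m r \<noteq> m (r - 1)"
    proof
      assume "m r = m (r - 1)"
      then have "x = int (m (r - 1)) - int (r - 1) - 1"
        using r that by simp
      then show False
        using assms(3) by (auto simp: beta_def)
    qed
    moreover have "m r \<le> m (r - 1)" "m (r - 1) \<le> m p"
      using m that by (auto intro: antimonoD)
    ultimately show ?thesis by simp
  qed
  have "antimono l"
  proof (rule antimonoI)
    fix p q :: nat
    assume "p \<le> q"
    then show "l q \<le> l p"
      using antimonoD[OF m, of p q] gt[of p] by (auto simp: l_def)
  qed
  moreover have "finite {q. l q \<noteq> 0}"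
    by (rule finite_subset[of _ "insert r {q. m q \<noteq> 0}"])
      (use assms(1) in \<open>auto simp: l_def is_partition_def\<close>)
  moreover have "beta l = insert x (beta m - {x - 1})"
  proof -
    have "beta l = insert (int (l r) - int r - 1) ((\<lambda>q. int (l q) - int q - 1) ` (UNIV - {r}))"
      unfolding beta_def by auto
    also have "(\<lambda>q. int (l q) - int q - 1) ` (UNIV - {r}) = (\<lambda>q. int (m q) - int q - 1) ` (UNIV - {r})"
      by (rule image_cong) (auto simp: l_def)
    also have "\<dots> = beta m - {x - 1}"
      unfolding beta_def r by (auto simp: beta_eq_iff[OF m])
    also have "int (l r) - int r - 1 = x"
      using r by (simp add: l_def)
    finally show ?thesis .
  qed
  ultimately show ?thesis
    unfolding is_partition_def by blast
qed

text \<open>Modulo 1 there is a single runner, so charge 0 makes \<open>{..<0}\<close> the core of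
  \<open>A\<close>. Reversing the descent builds the partition one node at a time.\<close>

lemma beta_surj:
  assumes "maya A" and "wt (\<lambda>_. 1) A = 0"
  obtains l where "is_partition l" and "beta l = A"
proof -
  have zero: "beta (\<lambda>_. 0) = {..<0}" "is_partition (\<lambda>_. 0)"
  proof -
    have "k \<in> range (\<lambda>r. - int r - 1)" if "k < 0" for k
      by (rule image_eqI[of _ _ "nat (- k - 1)"]) (use that in auto)
    then show "beta (\<lambda>_. 0) = {..<0}"
      by (auto simp: beta_def)
  qed (simp add: is_partition_def monotone_on_def)
  have "sim 1 A {..<0}"
    unfolding sim_def
  proof (intro allI impI)
    fix \<phi> :: "int \<Rightarrow> int"
    assume "\<forall>k. \<phi> (k + 1) = \<phi> k"
    then have "\<phi> k = \<phi> 0" for k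
      using periodic_dvd[of \<phi> 1 k 0] by simp
    then have "wt \<phi> X = wt (\<lambda>_. \<phi> 0) X" for X
      unfolding wt_def by (metis sum.cong)
    then show "wt \<phi> A = wt \<phi> {..<0}"
      using assms(2) by (simp add: wt_def)
  qed
  moreover have "maya {..<0}" "sclosed 1 {..<0}"
    by (simp_all add: maya_def sclosed_def)
  ultimately obtain n where "(mv 1 ^^ n) A {..<0}"
    using mv_to_core[OF assms(1), of "{..<0}" 1] by auto
  then have "\<exists>l. is_partition l \<and> beta l = A"
    using assms(1)
  proof (induction n arbitrary: A)
    case 0
    then show ?case
      using zero by auto
  next
    case (Suc n)
    then obtain C where C: "mv 1 A C" "(mv 1 ^^ n) C {..<0}"
      by (meson relpowp_Suc_D2)
    then obtain m where m: "is_partition m" "beta m = C"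
      using Suc.IH mv_props[OF Suc.prems(2) C(1)] by blast
    obtain x where x: "x \<in> A" "x - 1 \<notin> A" "C = insert (x - 1) (A - {x})"
      using C by (auto simp: mv_def)
    then have "A = insert x (C - {x - 1})"
      by auto
    then show ?case
      using beta_add_node[OF m(1), of x] m(2) x by auto
  qed
  then show ?thesis
    using that by blast
qed

section \<open>Rim hooks as bead moves\<close>

lemma diagram_iff [simp]: "(r, c) \<in> diagram l \<longleftrightarrow> c < l r"
  by (simp add: diagram_def)

lemma finite_diagram: "is_partition l \<Longrightarrow> finite (diagram l)"
  and card_diagram: "is_partition l \<Longrightarrow> card (diagram l) = psize l"
proof -
  have eq: "diagram l = (SIGMA r:{r. l r \<noteq> 0}. {..<l r})"
    by (auto simp: diagram_def)
  show "finite (diagram l)" "card (diagram l) = psize l" if "is_partition l"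
    using that unfolding eq by (auto simp: is_partition_def psize_def)
qed

text \<open>For a hook in rows \<open>a\<close> to \<open>b\<close>, each row of \<open>m\<close>
  above \<open>b\<close> is the next row of \<open>l\<close> shortened by one and hence has the same
  beta number. Only the bead of row \<open>a\<close> is lost, and only that of row \<open>b\<close>
  is new.\<close>

lemma beta_shift_rows:
  assumes "antimono l" and "a \<le> b"
    and out: "\<And>r. r < a \<or> b < r \<Longrightarrow> m r = l r"
    and inside: "\<And>r. a \<le> r \<Longrightarrow> r < b \<Longrightarrow> m r + 1 = l (r + 1)"
  shows "beta m = insert (int (m b) - int b - 1) (beta l - {int (l a) - int a - 1})"
proof -
  let ?l = "\<lambda>r. int (l r) - int r - 1" and ?m = "\<lambda>r. int (m r) - int r - 1"
  have "?m r = ?l (if r < a \<or> b < r then r else r + 1)" if "r \<noteq> b" for r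
    using out[of r] inside[of r] that by auto
  then have "?m ` (UNIV - {b}) = ?l ` (\<lambda>r. if r < a \<or> b < r then r else r + 1) ` (UNIV - {b})"
    unfolding image_image by (intro image_cong) auto
  also have "(\<lambda>r. if r < a \<or> b < r then r else r + 1) ` (UNIV - {b}) = UNIV - {a}" (is "?f ` _ = _")
  proof (intro equalityI subsetI)
    fix q
    assume q: "q \<in> UNIV - {a}"
    show "q \<in> ?f ` (UNIV - {b})"
    proof (cases "q < a \<or> b < q")
      case True
      then show ?thesis
        using assms(2) by (intro image_eqI[of _ _ q]) auto
    next
      case False
      then show ?thesis
        using q by (intro image_eqI[of _ _ "q - 1"]) auto
    qed
  qed (use assms(2) in auto)
  also have "?l ` (UNIV - {a}) = beta l - {?l a}"
    unfolding beta_def by (auto simp: beta_eq_iff[OF assms(1)])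
  finally show ?thesis
    unfolding beta_def by auto
qed

text \<open>A path from row at most \<open>r\<close> to a row beyond must contain a vertical step
  between rows \<open>r\<close> and \<open>r + 1\<close>.\<close>

lemma connected_nodes_cut:
  assumes "connected_nodes H" and "x \<in> H" and "y \<in> H" and "fst x \<le> r" and "r < fst y"
  obtains c where "(r, c) \<in> H" and "(r + 1, c) \<in> H"
proof -
  have "(\<lambda>a b. a \<in> H \<and> b \<in> H \<and> adjacent a b)\<^sup>*\<^sup>* x y"
    using assms(1-3) by (auto simp: connected_nodes_def)
  then have "r < fst y \<longrightarrow> (\<exists>c. (r, c) \<in> H \<and> (r + 1, c) \<in> H)"
  proof (induction rule: rtranclp_induct)
    case base
    then show ?case using assms(4) by simp
  next
    case (step y z)
    show ?case
    proof (cases "r < fst y")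
      case False
      have *: "y \<in> H" "z \<in> H" "adjacent y z"
        using step by auto
      show ?thesis
      proof
        assume "r < fst z"
        then have "fst y = r" "fst z = r + 1" "snd z = snd y"
          using * False by (auto simp: adjacent_def)
        then show "\<exists>c. (r, c) \<in> H \<and> (r + 1, c) \<in> H"
          using * by (metis prod.collapse)
      qed
    qed (use step in auto)
  qed
  then show ?thesis
    using that assms(5) by blast
qed

lemma mv_if_removes:
  assumes l: "is_partition l" and "removes_rim_s_hook s l m"
  shows "mv (int s) (beta l) (beta m)"
proof -
  obtain H where H: "H \<subseteq> rim l" "connected_nodes H" "card H = s" "diagram m = diagram l - H"
    and m: "is_partition m"
    using assms(2) by (auto simp: removes_rim_s_hook_def rim_hook_def)
  have al: "antimono l" and am: "antimono m"
    using l m by (auto simp: is_partition_def)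
  have Hl: "H \<subseteq> diagram l"
    using H(1) by (auto simp: rim_def)
  have mem: "(r, c) \<in> H \<longleftrightarrow> m r \<le> c \<and> c < l r" for r c
  proof -
    have "(r, c) \<in> diagram m \<longleftrightarrow> (r, c) \<in> diagram l \<and> (r, c) \<notin> H"
      using H(4) by simp
    moreover have "(r, c) \<in> diagram l" if "(r, c) \<in> H"
      using that Hl by blast
    ultimately show ?thesis
      by auto
  qed
  have le: "m r \<le> l r" for r
  proof (rule ccontr)
    assume "\<not> m r \<le> l r"
    then have "(r, l r) \<in> diagram m" by simp
    then show False using H(4) by simp
  qed
  have fin: "finite H"
    using Hl finite_diagram[OF l] by (rule finite_subset)
  have ne: "H \<noteq> {}"
    using H(2) by (simp add: connected_nodes_def)
  define a where "a = Min (fst ` H)"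
  define b where "b = Max (fst ` H)"
  have "a \<in> fst ` H" "b \<in> fst ` H"
    using fin ne by (auto simp: a_def b_def)
  then obtain x y where x: "x \<in> H" "fst x = a" and y: "y \<in> H" "fst y = b"
    by auto
  have ab: "a \<le> r" "r \<le> b" if "(r, c) \<in> H" for r c
  proof -
    have "r \<in> fst ` H"
      using that by force
    then show "a \<le> r" "r \<le> b"
      using fin by (simp_all add: a_def b_def)
  qed
  have "a \<le> b"
    using ab[of a "snd x"] x by auto
  have out: "m r = l r" if "r < a \<or> b < r" for r
  proof (rule ccontr)
    assume "m r \<noteq> l r"
    then have "(r, m r) \<in> H"
      using le[of r] by (simp add: mem)
    then show False
      using ab[of r "m r"] that by auto
  qed
  \<comment> \<open>Connectedness puts some column \<open>c\<close> in both rows, which gives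
    \<open>m r < l (r + 1)\<close>; that \<open>(r, m r)\<close> lies on the rim gives the opposite
    bound.\<close>
  have inn: "m r + 1 = l (r + 1)" if "a \<le> r" "r < b" for r
  proof -
    have "fst x \<le> r" "r < fst y"
      using x y that by auto
    then obtain c where c: "(r, c) \<in> H" "(r + 1, c) \<in> H"
      by (rule connected_nodes_cut[OF H(2) x(1) y(1)])
    then have "m r < l r" "m r \<le> c" "c < l (r + 1)"
      by (auto simp: mem)
    then have "(r, m r) \<in> rim l"
      using H(1) mem[of r "m r"] by auto
    then have "l (r + 1) \<le> m r + 1"
      by (simp add: rim_def)
    then show ?thesis
      using \<open>m r \<le> c\<close> \<open>c < l (r + 1)\<close> by simp
  qed
  let ?x = "int (l a) - int a - 1" and ?y = "int (m b) - int b - 1"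
  have beta: "beta m = insert ?y (beta l - {?x})"
    by (rule beta_shift_rows[OF al \<open>a \<le> b\<close> out inn])
  have x': "?x \<in> beta l"
    by (simp add: beta_def)
  have y': "?y \<notin> beta l"
  proof
    assume "?y \<in> beta l"
    then obtain q where q: "?y = int (l q) - int q - 1"
      by (auto simp: beta_def)
    have "m b < l b"
      using y mem[of b "snd y"] by auto
    then have "b < q"
      using q beta_less[OF al, of q b] by (cases b q rule: linorder_cases) auto
    then show False
      using q out[of q] beta_eq_iff[OF am, of b q] by simp
  qed
  have "H = diagram l - diagram m" "diagram m \<subseteq> diagram l"
    using H(4) Hl by auto
  then have "card H = card (diagram l) - card (diagram m)"
    using card_Diff_subset[OF finite_diagram[OF m]] by simp
  moreover have "card (diagram m) \<le> card (diagram l)"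
    using H(4) finite_diagram[OF l] by (simp add: card_mono)
  \<comment> \<open>The number of removed nodes is the loss of energy, and this is the distance
    moved by the bead.\<close>
  ultimately have "int s = int (psize l) - int (psize m)"
    using H(3) card_diagram l m by simp
  also have "\<dots> = ?x - ?y"
    using wt_move[OF maya_beta[OF l] x' y', of "\<lambda>k. k"] energy_beta[OF l] energy_beta[OF m]
    by (simp add: beta)
  finally have eq: "?y = ?x - int s"
    by simp
  show ?thesis
    unfolding mv_def using x' y'[unfolded eq] beta[unfolded eq] by blast
qed

text \<open>The hook starts in the row \<open>a\<close> of the moved bead and ends in the last row
  \<open>b\<close> whose bead lies above the target \<open>y\<close>. Rows from \<open>a\<close> to
  \<open>b - 1\<close> become the following rows minus one, and row \<open>b\<close> receives the
  bead \<open>y\<close>.\<close>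

lemma removes_if_mv:
  assumes l: "is_partition l" and "s > 0" and "mv (int s) (beta l) B"
  shows "\<exists>m. removes_rim_s_hook s l m \<and> beta m = B"
proof -
  obtain x where x: "x \<in> beta l" "x - int s \<notin> beta l"
    and B: "B = insert (x - int s) (beta l - {x})"
    using assms(3) by (auto simp: mv_def)
  define y where "y = x - int s"
  have al: "antimono l"
    using l by (simp add: is_partition_def)
  obtain a where a: "x = int (l a) - int a - 1"
    using x by (auto simp: beta_def)
  obtain N where N: "\<And>r. r \<ge> N \<Longrightarrow> l r = 0"
    using partition_bound[OF l] by blast
  define R where "R = {r. y < int (l r) - int r - 1}"
  have "r \<le> N + nat (- y)" if "r \<in> R" for r
    using that N[of r] by (cases "r \<ge> N") (auto simp: R_def)
  then have finR: "finite R"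
    by (meson finite_nat_set_iff_bounded_le)
  have "a \<in> R"
    using a assms(2) by (simp add: R_def y_def)
  define b where "b = Max R"
  have "b \<in> R" "a \<le> b"
    unfolding b_def using finR \<open>a \<in> R\<close> by (auto intro: Max_in)
  have "b + 1 \<notin> R"
  proof
    assume "b + 1 \<in> R"
    then have "b + 1 \<le> b"
      unfolding b_def using finR by (rule Max_ge[rotated])
    then show False by simp
  qed
  then have "int (l (b + 1)) - int (b + 1) - 1 \<le> y"
    by (simp add: R_def)
  moreover have "int (l (b + 1)) - int (b + 1) - 1 \<noteq> y"
  proof
    assume "int (l (b + 1)) - int (b + 1) - 1 = y"
    then have "y \<in> beta l"
      unfolding beta_def by blast
    then show False
      using x by (simp add: y_def)
  qed
  ultimately have y_ge: "int (l (b + 1)) \<le> y + int b + 1"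
    by simp
  have y_less: "y + int b + 1 < int (l b)"
    using \<open>b \<in> R\<close> by (simp add: R_def)
  define m where "m r = (if r < a \<or> b < r then l r else if r < b then l (r + 1) - 1
      else nat (y + int b + 1))" for r
  \<comment> \<open>By \<open>y_ge\<close> the argument of \<open>nat\<close> is nonnegative, so
    nothing is truncated.\<close>
  have mb: "int (m b) = y + int b + 1"
    using \<open>a \<le> b\<close> y_ge by (simp add: m_def)
  have pos: "l r \<ge> 1" if "r \<le> b" for r
    using antimonoD[OF al that] y_less y_ge by linarith
  have inn: "m r + 1 = l (r + 1)" if "a \<le> r" "r < b" for r
    using that pos[of "r + 1"] by (simp add: m_def)
  have out: "m r = l r" if "r < a \<or> b < r" for r
    using that by (simp add: m_def)
  have less: "m r < l r" if "a \<le> r" "r \<le> b" for r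
    using that inn[of r] antimonoD[OF al, of r "r + 1"] mb y_less by (cases "r = b") auto
  have le: "m r \<le> l r" for r
    using less[of r] out[of r] by (cases "r < a \<or> b < r") auto
  have step: "m (Suc r) \<le> m r" for r
  proof -
    consider "r < a \<or> b < r" | "a \<le> r" "r < b" | "r = b" by linarith
    then show ?thesis
    proof cases
      case 1
      then show ?thesis
        using le[of "Suc r"] antimonoD[OF al, of r "Suc r"] out[of r] by simp
    next
      case 2
      then show ?thesis
        using less[of "Suc r"] inn[of r] by simp
    next
      case 3
      then show ?thesis
        using out[of "Suc b"] y_ge mb by simp
    qed
  qed
  have am: "antimono m"
    using step by (simp add: antimono_iff_le_Suc)
  have "finite {r. m r \<noteq> 0}"
    by (rule finite_subset[of _ "{r. l r \<noteq> 0}"])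
      (use l le in \<open>auto simp: is_partition_def, metis le_zero_eq neq0_conv\<close>)
  with am have m: "is_partition m"
    by (simp add: is_partition_def)
  define H where "H = diagram l - diagram m"
  have mem: "(r, c) \<in> H \<longleftrightarrow> m r \<le> c \<and> c < l r" for r c
    by (auto simp: H_def)
  have rows: "a \<le> r \<and> r \<le> b" if "(r, c) \<in> H" for r c
    using that out[of r] by (cases "r < a \<or> b < r") (auto simp: mem)
  have rim: "H \<subseteq> rim l"
  proof (clarify)
    fix r c
    assume rc: "(r, c) \<in> H"
    then have "l (r + 1) \<le> m r + 1"
      using rows[OF rc] inn[of r] mb y_ge by (cases "r = b") auto
    then show "(r, c) \<in> rim l"
      using rc by (simp add: rim_def mem)
  qed
  define E where "E = (\<lambda>p q. p \<in> H \<and> q \<in> H \<and> adjacent p q)"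
  \<comment> \<open>Every node is joined to the end of the top row: go right to the end of the row,
    then up, and repeat.\<close>
  let ?o = "(a, l a - 1)"
  have row_end: "E\<^sup>*\<^sup>* (r, c) (r, l r - 1)" if "(r, c) \<in> H" for r c
    using that
  proof (induction "l r - c" arbitrary: c)
    case 0
    then show ?case by (simp add: mem)
  next
    case (Suc n)
    show ?case
    proof (cases "c = l r - 1")
      case False
      then have c: "(r, c + 1) \<in> H"
        using Suc.prems by (auto simp: mem)
      then have "E\<^sup>*\<^sup>* (r, c + 1) (r, l r - 1)"
        using Suc by simp
      moreover have "E (r, c) (r, c + 1)"
        using c Suc.prems by (simp add: E_def adjacent_def)
      ultimately show ?thesis
        by (meson converse_rtranclp_into_rtranclp)
    qed simp
  qed
  have to_top: "E\<^sup>*\<^sup>* (r, l r - 1) ?o" if "a \<le> r" "r \<le> b" for r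
    using that
  proof (induction r rule: dec_induct)
    case (step r)
    have up: "(r + 1, l (r + 1) - 1) \<in> H" "(r, l (r + 1) - 1) \<in> H"
      using inn[of r] less[of "r + 1"] less[of r] step by (auto simp: mem)
    have "E (r + 1, l (r + 1) - 1) (r, l (r + 1) - 1)"
      using up by (simp add: E_def adjacent_def)
    moreover have "E\<^sup>*\<^sup>* (r, l r - 1) ?o"
      using step by simp
    ultimately have "E\<^sup>*\<^sup>* (r + 1, l (r + 1) - 1) ?o"
      using row_end[OF up(2)] by (meson converse_rtranclp_into_rtranclp rtranclp_trans)
    then show ?case by simp
  qed simp
  have conn: "E\<^sup>*\<^sup>* p ?o" if "p \<in> H" for p
  proof -
    obtain r c where p: "p = (r, c)" by force
    show ?thesis
      using row_end[of r c] to_top[of r] rows[of r c] that unfolding p by (meson rtranclp_trans)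
  qed
  have "symp E"
    by (auto simp: symp_def E_def adjacent_def)
  then have "symp E\<^sup>*\<^sup>*"
    by (rule symp_rtranclp)
  then have "E\<^sup>*\<^sup>* p q" if "p \<in> H" "q \<in> H" for p q
    using conn[OF that(1)] conn[OF that(2)] by (meson rtranclp_trans sympD)
  moreover have "(b, m b) \<in> H"
    using less[of b] \<open>a \<le> b\<close> by (simp add: mem)
  ultimately have "connected_nodes H"
    unfolding connected_nodes_def E_def by blast
  moreover have diag: "diagram m = diagram l - H"
    using le by (auto simp: H_def diagram_def) (meson le_trans not_le)
  ultimately have hook: "rim_hook l H"
    using rim m by (auto simp: rim_hook_def)
  have beta: "beta m = B"
    using beta_shift_rows[OF al \<open>a \<le> b\<close> out inn] by (simp add: B mb a[symmetric] y_def)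
  \<comment> \<open>The nodes of \<open>H\<close> are not counted directly: removing
    \<open>H\<close> and the given move lead to the same \<open>B\<close>, so their energy losses
    agree.\<close>
  have "removes_rim_s_hook (card H) l m"
    using hook m diag by (auto simp: removes_rim_s_hook_def)
  then have "mv (int (card H)) (beta l) B"
    unfolding beta[symmetric] by (rule mv_if_removes[OF l])
  from mv_props(3)[OF maya_beta[OF l] this] mv_props(3)[OF maya_beta[OF l] assms(3)]
  have "card H = s"
    by simp
  then show ?thesis
    using \<open>removes_rim_s_hook (card H) l m\<close> beta by auto
qed

lemma removes_iff_mv:
  assumes "is_partition l" and "s > 0"
  shows "removes_rim_s_hook s l m \<longleftrightarrow> is_partition m \<and> mv (int s) (beta l) (beta m)"
proof
  assume "is_partition m \<and> mv (int s) (beta l) (beta m)"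
  then obtain k where "removes_rim_s_hook s l k" "beta k = beta m" "is_partition m"
    using removes_if_mv[OF assms, of "beta m"] by blast
  moreover from this have "k = m"
    by (intro beta_inj) (auto simp: removes_rim_s_hook_def is_partition_def)
  ultimately show "removes_rim_s_hook s l m" by simp
qed (use mv_if_removes[OF assms(1)] in \<open>auto simp: removes_rim_s_hook_def\<close>)

lemma removes_rim_hook_iff:
  assumes "is_partition l"
  shows "removes_rim_hook l m \<longleftrightarrow> (\<exists>s>0. removes_rim_s_hook s l m)"
proof -
  have "card H > 0" if "rim_hook l H" for H
  proof -
    have "H \<subseteq> diagram l" "H \<noteq> {}"
      using that by (auto simp: rim_hook_def rim_def connected_nodes_def)
    then show ?thesis
      using finite_diagram[OF assms] by (meson card_gt_0_iff finite_subset)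
  qed
  then show ?thesis
    by (auto simp: removes_rim_hook_def removes_rim_s_hook_def)
qed

section \<open>Cores and weights of partitions\<close>

lemma is_core_iff:
  assumes "s > 0"
  shows "is_core s l \<longleftrightarrow> is_partition l \<and> sclosed (int s) (beta l)"
proof (cases "is_partition l")
  case True
  have "(\<exists>H. rim_hook l H \<and> card H = s) \<longleftrightarrow> (\<exists>m. removes_rim_s_hook s l m)"
    by (auto simp: removes_rim_s_hook_def rim_hook_def)
  also have "\<dots> \<longleftrightarrow> (\<exists>B. mv (int s) (beta l) B)"
    using removes_if_mv[OF True assms] mv_if_removes[OF True] by blast
  also have "\<dots> \<longleftrightarrow> \<not> sclosed (int s) (beta l)"
    by (auto simp: mv_def sclosed_def)
  finally show ?thesis
    using True by (simp add: is_core_def)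
qed (simp add: is_core_def)

lemma removes_pow_iff:
  assumes "is_partition l" and "s > 0"
  shows "(removes_rim_s_hook s ^^ n) l m \<longleftrightarrow> is_partition m \<and> (mv (int s) ^^ n) (beta l) (beta m)"
proof (induction n arbitrary: m)
  case 0
  show ?case
    using assms(1) beta_inj[of l m] by (auto simp: is_partition_def)
next
  case (Suc n)
  show ?case
  proof
    assume "(removes_rim_s_hook s ^^ Suc n) l m"
    then obtain k where "(removes_rim_s_hook s ^^ n) l k" "removes_rim_s_hook s k m"
      by auto
    then show "is_partition m \<and> (mv (int s) ^^ Suc n) (beta l) (beta m)"
      using Suc removes_iff_mv[OF _ assms(2), of k m] by auto
  next
    assume *: "is_partition m \<and> (mv (int s) ^^ Suc n) (beta l) (beta m)"
    then obtain B where B: "(mv (int s) ^^ n) (beta l) B" "mv (int s) B (beta m)"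
      by auto
    \<comment> \<open>Moves preserve the charge, so the intermediate configuration comes from a
      partition.\<close>
    have "maya B" "wt (\<lambda>_. 1) B = 0"
      using mv_pow_props[OF maya_beta[OF assms(1)] B(1)] charge_beta[OF assms(1)]
      by (auto simp: sim_def)
    then obtain k where "is_partition k" "beta k = B"
      by (rule beta_surj)
    then show "(removes_rim_s_hook s ^^ Suc n) l m"
      using B Suc removes_iff_mv[OF _ assms(2), of k m] * by auto
  qed
qed

text \<open>This justifies both definite descriptions: the flush configuration reached is unique,
  and the energy lost fixes the number of moves.\<close>

lemma cor_wei:
  assumes "is_partition l" and "s > 0"
  shows is_core_cor: "is_core s (cor s l)"
    and sim_cor: "sim (int s) (beta l) (beta (cor s l))"
    and psize_cor_wei: "psize l = psize (cor s l) + s * wei s l"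
proof -
  obtain n B where nB: "(mv (int s) ^^ n) (beta l) B" "sclosed (int s) B"
    using mv_to_sclosed[OF maya_beta[OF assms(1)], of "int s"] assms(2) by auto
  note B = mv_pow_props[OF maya_beta[OF assms(1)] nB(1)]
  have "maya B" "wt (\<lambda>_. 1) B = 0"
    using B charge_beta[OF assms(1)] by (auto simp: sim_def)
  then obtain m where m: "is_partition m" "beta m = B"
    by (rule beta_surj)
  have core: "is_core s m"
    using m nB assms(2) by (simp add: is_core_iff)
  have pow: "(removes_rim_s_hook s ^^ n) l m"
    using m nB removes_pow_iff[OF assms] by simp
  have unique: "m' = m \<and> n' = n" if "(removes_rim_s_hook s ^^ n') l m'" "is_core s m'" for m' n'
  proof -
    have m': "is_partition m'" "sclosed (int s) (beta m')" "(mv (int s) ^^ n') (beta l) (beta m')"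
      using that removes_pow_iff[OF assms] assms(2) by (auto simp: is_core_iff)
    note B' = mv_pow_props[OF maya_beta[OF assms(1)] m'(3)]
    have "beta m' = B"
      by (rule sclosed_unique[of _ _ "int s"]) (use m' nB B B' in \<open>blast intro: sim_sym sim_trans\<close>)+
    then have "m' = m"
      using m m' by (intro beta_inj) (auto simp: is_partition_def)
    moreover have "int s * int n' = int s * int n"
      using B B' unfolding \<open>beta m' = B\<close> by linarith
    ultimately show ?thesis
      using assms(2) by simp
  qed
  have cor: "cor s l = m"
    unfolding cor_def
  proof (rule the_equality)
    show "(removes_rim_s_hook s)\<^sup>*\<^sup>* l m \<and> is_core s m"
      using relpowp_imp_rtranclp[OF pow] core by simp
    show "m' = m" if "(removes_rim_s_hook s)\<^sup>*\<^sup>* l m' \<and> is_core s m'" for m'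
      using that unique[of _ m'] rtranclp_imp_relpowp[of "removes_rim_s_hook s" l m'] by blast
  qed
  have wei: "wei s l = n"
    unfolding wei_def
  proof (rule the_equality)
    show "\<exists>m. (removes_rim_s_hook s ^^ n) l m \<and> is_core s m"
      using pow core by blast
    show "k = n" if "\<exists>m. (removes_rim_s_hook s ^^ k) l m \<and> is_core s m" for k
      using that unique[of k] by blast
  qed
  show "is_core s (cor s l)" "sim (int s) (beta l) (beta (cor s l))"
    using core B m by (simp_all add: cor)
  have "int (psize l) = int (psize m) + int s * int n"
    using B energy_beta[OF assms(1)] energy_beta[OF m(1)] m by simp
  then show "psize l = psize (cor s l) + s * wei s l"
    unfolding cor wei by (metis of_nat_add of_nat_eq_iff of_nat_mult)
qed

lemma core_unique:
  assumes "s > 0" and "is_core s l" and "is_core s m" and "sim (int s) (beta l) (beta m)"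
  shows "l = m"
proof (rule beta_inj)
  show "beta l = beta m"
    by (rule sclosed_unique[of _ _ "int s"]) (use assms in \<open>auto simp: is_core_iff maya_beta\<close>)
qed (use assms in \<open>auto simp: is_core_def is_partition_def\<close>)

lemma cor_eq_iff:
  assumes "is_partition l" and "s > 0" and "is_core s c"
  shows "cor s l = c \<longleftrightarrow> sim (int s) (beta l) (beta c)"
proof
  assume "sim (int s) (beta l) (beta c)"
  then have "sim (int s) (beta (cor s l)) (beta c)"
    by (rule sim_trans[OF sim_sym[OF sim_cor[OF assms(1,2)]]])
  then show "cor s l = c"
    by (rule core_unique[OF assms(2) is_core_cor[OF assms(1,2)] assms(3)])
qed (use sim_cor[OF assms(1,2)] in blast)

section \<open>Conjugation of partitions\<close>

lemma less_conjugate_iff: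
  assumes "is_partition l"
  shows "r < conjugate l c \<longleftrightarrow> c < l r"
proof -
  have l: "antimono l"
    using assms by (simp add: is_partition_def)
  obtain N where "\<And>r. r \<ge> N \<Longrightarrow> l r = 0"
    using partition_bound[OF assms] by blast
  then have ex: "\<not> c < l N"
    by simp
  define k where "k = (LEAST r. \<not> c < l r)"
  have k: "\<not> c < l k"
    unfolding k_def using ex by (rule LeastI)
  have "c < l r \<longleftrightarrow> r < k" for r
  proof
    show "c < l r" if "r < k"
      using not_less_Least[of r "\<lambda>r. \<not> c < l r"] that unfolding k_def by blast
    show "r < k" if "c < l r"
      using k antimonoD[OF l, of k r] that by (cases "r < k") auto
  qed
  moreover from this have "{r. (r, c) \<in> diagram l} = {..<k}"
    by auto
  ultimately show ?thesis
    by (simp add: conjugate_def)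
qed

lemma is_partition_conjugate:
  assumes "is_partition l"
  shows "is_partition (conjugate l)"
proof -
  have "conjugate l d \<le> conjugate l c" if "c \<le> d" for c d
    using less_conjugate_iff[OF assms, of "conjugate l c" c]
      less_conjugate_iff[OF assms, of "conjugate l c" d] that
    by (cases "conjugate l c < conjugate l d") auto
  moreover have "{c. conjugate l c \<noteq> 0} \<subseteq> {..<l 0}"
    using less_conjugate_iff[OF assms, of 0] by auto
  then have "finite {c. conjugate l c \<noteq> 0}"
    by (rule finite_subset) simp
  ultimately show ?thesis
    by (simp add: is_partition_def monotone_on_def)
qed

text \<open>One inclusion suffices, because both configurations have charge 0 and therefore differ
  by equally many beads in each direction.\<close>

lemma beta_conjugate:
  assumes "is_partition l"
  shows "beta (conjugate l) = reflect (beta l)"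
proof -
  note c = is_partition_conjugate[OF assms]
  have sub: "beta (conjugate l) \<subseteq> reflect (beta l)"
  proof
    fix k
    assume "k \<in> beta (conjugate l)"
    then obtain c where k: "k = int (conjugate l c) - int c - 1"
      by (auto simp: beta_def)
    \<comment> \<open>Equality would mean \<open>l r + conjugate l c = r + c + 1\<close>, but this
      sum is at least \<open>r + c + 2\<close> if \<open>(r, c)\<close> is a node and at most
      \<open>r + c\<close> otherwise.\<close>
    have "- 1 - k \<noteq> int (l r) - int r - 1" for r
      using less_conjugate_iff[OF assms, of r c] k by (cases "c < l r") auto
    then show "k \<in> reflect (beta l)"
      by (auto simp: reflect_def beta_def)
  qed
  have maya: "maya (beta (conjugate l))" "maya (reflect (beta l))"
    using maya_beta assms c maya_reflect by auto
  have "int (card (reflect (beta l) - beta (conjugate l)))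
      - int (card (beta (conjugate l) - reflect (beta l))) = 0"
    using wt_diff[OF maya(2,1), of "\<lambda>_. 1"] charge_beta[OF c] charge_beta[OF assms]
    by (simp add: wt_reflect)
  moreover have empty: "beta (conjugate l) - reflect (beta l) = {}"
    using sub by blast
  ultimately have "card (reflect (beta l) - beta (conjugate l)) = 0"
    unfolding empty by simp
  then show ?thesis
    using maya_finite_diff[OF maya(2,1)] sub by auto
qed

lemma psize_conjugate:
  assumes "is_partition l"
  shows "psize (conjugate l) = psize l"
  using energy_beta[OF assms] energy_beta[OF is_partition_conjugate[OF assms]] charge_beta[OF assms]
  by (simp add: beta_conjugate[OF assms] energy_reflect)

lemma conjugate_conjugate:
  assumes "is_partition l"
  shows "conjugate (conjugate l) = l"
proof (rule beta_inj)
  note c = is_partition_conjugate[OF assms]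
  show "beta (conjugate (conjugate l)) = beta l"
    by (simp add: beta_conjugate[OF c] beta_conjugate[OF assms])
  show "antimono (conjugate (conjugate l))" "antimono l"
    using is_partition_conjugate[OF c] assms by (auto simp: is_partition_def)
qed

lemma is_core_conjugate:
  assumes "s > 0" and "is_core s l"
  shows "is_core s (conjugate l)"
  using assms is_partition_conjugate[of l] sclosed_reflect[of "int s" "beta l"]
  by (simp add: is_core_iff beta_conjugate)

lemma cor_conjugate:
  assumes "is_partition l" and "s > 0"
  shows "cor s (conjugate l) = conjugate (cor s l)"
proof -
  have core: "is_core s (cor s l)"
    by (rule is_core_cor[OF assms])
  then have "is_partition (cor s l)"
    by (simp add: is_core_def)
  then show ?thesis
    using cor_eq_iff[OF is_partition_conjugate[OF assms(1)] assms(2) is_core_conjugate[OF assms(2) core]]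
      sim_reflect[OF sim_cor[OF assms]] by (simp add: beta_conjugate assms(1))
qed

section \<open>Transfer between configurations and partitions\<close>

text \<open>A hook of unspecified length is a bead move over any distance; the direction decides
  between removing and adding.\<close>

lemma one_rim_hook_iff:
  assumes k: "is_partition k" and l: "is_partition l"
  shows "removes_rim_hook k l \<or> removes_rim_hook l k \<longleftrightarrow>
    (\<exists>x y. x \<in> beta k \<and> y \<notin> beta k \<and> beta l = insert y (beta k - {x}))"
proof -
  have iff: "removes_rim_hook p q \<longleftrightarrow> (\<exists>s>0. mv (int s) (beta p) (beta q))"
    if "is_partition p" "is_partition q" for p q
    using removes_rim_hook_iff[OF that(1)] removes_iff_mv[OF that(1)] that(2) by auto
  show ?thesis
  proof
    assume "removes_rim_hook k l \<or> removes_rim_hook l k"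
    then show "\<exists>x y. x \<in> beta k \<and> y \<notin> beta k \<and> beta l = insert y (beta k - {x})"
    proof
      assume "removes_rim_hook k l"
      then show ?thesis
        unfolding iff[OF k l] mv_def by blast
    next
      assume "removes_rim_hook l k"
      then obtain s x where "s > 0" and x: "x \<in> beta l" "x - int s \<notin> beta l"
        and "beta k = insert (x - int s) (beta l - {x})"
        unfolding iff[OF l k] mv_def by blast
      then show ?thesis
        by (intro exI[of _ "x - int s"] exI[of _ x]) auto
    qed
  next
    assume "\<exists>x y. x \<in> beta k \<and> y \<notin> beta k \<and> beta l = insert y (beta k - {x})"
    then obtain x y where xy: "x \<in> beta k" "y \<notin> beta k" "beta l = insert y (beta k - {x})"
      by blast
    show "removes_rim_hook k l \<or> removes_rim_hook l k"
    proof (cases "y < x")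
      case True
      then have "mv (int (nat (x - y))) (beta k) (beta l)"
        unfolding mv_def by (intro bexI[of _ x]) (use xy True in simp_all)
      then show ?thesis
        unfolding iff[OF k l] using True by (intro disjI1 exI[of _ "nat (x - y)"]) simp
    next
      case False
      then have "x < y"
        using xy by (cases x y rule: linorder_cases) auto
      moreover have "y \<in> beta l" "x \<notin> beta l" "beta k = insert x (beta l - {y})"
        using xy by auto
      ultimately have "mv (int (nat (y - x))) (beta l) (beta k)"
        unfolding mv_def by (intro bexI[of _ y]) simp_all
      then show ?thesis
        unfolding iff[OF l k] using \<open>x < y\<close> by (intro disjI2 exI[of _ "nat (y - x)"]) simp
    qed
  qed
qed

lemma beta_partitions_with_cores:
  assumes "s > 0" and "t > 0" and "is_core s \<sigma>" and "is_core t \<tau>"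
  shows "beta ` partitions_with_cores s t \<sigma> \<tau> n =
    with_cores (int s) (int t) (beta \<sigma>) (beta \<tau>) (int n)"
proof (intro equalityI subsetI)
  fix A
  assume "A \<in> beta ` partitions_with_cores s t \<sigma> \<tau> n"
  then show "A \<in> with_cores (int s) (int t) (beta \<sigma>) (beta \<tau>) (int n)"
    using cor_eq_iff assms
    by (auto simp: partitions_with_cores_def with_cores_def maya_beta energy_beta sim_cor)
next
  fix A
  assume "A \<in> with_cores (int s) (int t) (beta \<sigma>) (beta \<tau>) (int n)"
  then have A: "maya A" "sim (int s) A (beta \<sigma>)" "sim (int t) A (beta \<tau>)" "energy A = int n"
    by (auto simp: with_cores_def)
  have "wt (\<lambda>_. 1) A = 0"
    using A(2) charge_beta[of \<sigma>] assms(3) by (simp add: sim_def is_core_def)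
  with A(1) obtain l where l: "is_partition l" "beta l = A"
    by (rule beta_surj)
  then have "l \<in> partitions_with_cores s t \<sigma> \<tau> n"
    using A cor_eq_iff[OF l(1)] assms energy_beta[OF l(1)] by (simp add: partitions_with_cores_def)
  then show "A \<in> beta ` partitions_with_cores s t \<sigma> \<tau> n"
    using l by blast
qed

lemma partitions_with_cores_conjugate:
  assumes "s > 0" and "t > 0" and "conjugate \<sigma> = \<sigma>" and "conjugate \<tau> = \<tau>"
    and "l \<in> partitions_with_cores s t \<sigma> \<tau> n"
  shows "conjugate l \<in> partitions_with_cores s t \<sigma> \<tau> n"
  using assms by (auto simp: partitions_with_cores_def is_partition_conjugate psize_conjugate cor_conjugate)

lemma partitions_with_cores_nonempty:
  assumes "coprime s t" and "s > 0" and "t > 0" and "is_core s \<sigma>" and "is_core t \<tau>"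
  shows "\<exists>n. partitions_with_cores s t \<sigma> \<tau> n \<noteq> {}"
proof -
  have part: "is_partition \<sigma>" "is_partition \<tau>"
    using assms by (auto simp: is_core_def)
  have "\<exists>C. maya C \<and> sim (int s) C (beta \<sigma>) \<and> sim (int t) C (beta \<tau>)"
    by (rule exists_maya_sim_both) (use assms part in \<open>simp_all add: maya_beta charge_beta\<close>)
  then obtain C where "C \<in> with_cores (int s) (int t) (beta \<sigma>) (beta \<tau>) (int (nat (energy C)))"
    using energy_nonneg by (auto simp: with_cores_def)
  then show ?thesis
    using beta_partitions_with_cores[OF assms(2-5)] by blast
qed

text \<open>The reflection maps \<open>A - B\<close> into \<open>B - A\<close>, so
  \<open>a + b = - 2 - (p + q)\<close>. With equal sums \<open>p + q = - 1\<close>, hence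
  \<open>p\<close> is reflected to \<open>q\<close>, which is not in \<open>B - A\<close>.\<close>

lemma swapped_rectangle_not_self_reflected:
  assumes "reflect A = A" and "reflect B = B"
    and "A - B = {p, q}" and "B - A = {a, b}" and "p + q = a + b" and "p \<noteq> q"
  shows False
proof -
  have swap: "- 1 - k \<in> B - A" if "k \<in> A - B" for k
  proof -
    have "k \<in> reflect A" "k \<notin> reflect B"
      using that assms(1,2) by auto
    then show ?thesis
      by (simp add: reflect_def)
  qed
  have "- 1 - p \<in> {a, b}" "- 1 - q \<in> {a, b}"
    using swap[of p] swap[of q] unfolding assms(3,4) by auto
  moreover have "p \<notin> {a, b}" "q \<notin> {a, b}"
    using assms(3,4) by blast+
  ultimately show False
    using assms(5,6) by auto
qed

theorem theorem5p13:
  fixes s t n :: nat and \<sigma> \<tau> :: "nat \<Rightarrow> nat"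
  assumes "s > 1" and "t > 1" and "coprime s t"
    and "is_core s \<sigma>" and "is_core t \<tau>"
  shows
    "((\<exists>l m. l \<noteq> m \<and> partitions_with_cores s t \<sigma> \<tau> n = {l, m} \<and> m = conjugate l)
      \<longleftrightarrow>
      (conjugate \<sigma> = \<sigma> \<and> conjugate \<tau> = \<tau> \<and>
       (removes_rim_hook (cor t \<sigma>) (cor s \<tau>) \<or> removes_rim_hook (cor s \<tau>) (cor t \<sigma>)) \<and>
       n = psize \<sigma> + s * (wei s \<tau> + 1) \<and> n = psize \<tau> + t * (wei t \<sigma> + 1)))
     \<and>
     ((conjugate \<sigma> = \<sigma> \<and> conjugate \<tau> = \<tau> \<and>
       (removes_rim_hook (cor t \<sigma>) (cor s \<tau>) \<or> removes_rim_hook (cor s \<tau>) (cor t \<sigma>)) \<and>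
       n = psize \<sigma> + s * (wei s \<tau> + 1) \<and> n = psize \<tau> + t * (wei t \<sigma> + 1))
      \<longleftrightarrow>
      (conjugate \<sigma> = \<sigma> \<and> conjugate \<tau> = \<tau> \<and> n = min_size s t \<sigma> \<tau> \<and>
       n = psize \<sigma> + s * (wei s \<tau> + 1) \<and> n = psize \<tau> + t * (wei t \<sigma> + 1)))"
proof -
  have pos: "s > 0" "t > 0" and st: "s \<noteq> t"
    using assms(1-3) by auto
  have ist: "coprime (int s) (int t)" "int s > 1" "int t > 1" "int s > 0" "int t > 0" "int s \<noteq> int t"
    using assms(1-3) st by auto
  have part: "is_partition \<sigma>" "is_partition \<tau>"
    using assms(4,5) by (auto simp: is_core_def)
  define P where "P = partitions_with_cores s t \<sigma> \<tau>"
  define hook where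
    "hook \<longleftrightarrow> removes_rim_hook (cor t \<sigma>) (cor s \<tau>) \<or> removes_rim_hook (cor s \<tau>) (cor t \<sigma>)"
  define W where "W \<longleftrightarrow> n = psize \<sigma> + s * (wei s \<tau> + 1) \<and> n = psize \<tau> + t * (wei t \<sigma> + 1)"
  define sc where "sc \<longleftrightarrow> conjugate \<sigma> = \<sigma> \<and> conjugate \<tau> = \<tau>"
  obtain h K L where h: "bij h"
    and K: "maya K" "sclosed (int s) K" "sclosed (int t) K" "sim (int s) (beta \<tau>) K"
    and L: "maya L" "sclosed (int s) L" "sclosed (int t) L" "sim (int t) (beta \<sigma>) L"
    and hPS: "\<And>A e. h ` A \<in> with_cores (int s) (int t) L K
        (e + (energy K - energy (beta \<tau>)) + (energy L - energy (beta \<sigma>))) \<longleftrightarrow>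
      A \<in> with_cores (int s) (int t) (beta \<sigma>) (beta \<tau>) e"
    and rect: "\<And>x. inv h x + inv h (x + int s + int t) = inv h (x + int s) + inv h (x + int t)"
    by (rule with_cores_reduce[OF ist(1-3) maya_beta[OF part(1)] maya_beta[OF part(2)]])
      (use assms(4,5) pos in \<open>auto simp: is_core_iff\<close>)
  have cor_part: "is_partition (cor s \<tau>)" "is_partition (cor t \<sigma>)"
    using is_core_cor part pos by (auto simp: is_core_def)
  have K_eq: "beta (cor s \<tau>) = K"
    by (rule sclosed_unique[of _ _ "int s"])
      (use K maya_beta[OF cor_part(1)] is_core_cor[OF part(2) pos(1)] sim_cor[OF part(2) pos(1)] pos
        in \<open>auto simp: is_core_iff intro: sim_trans sim_sym\<close>)
  have L_eq: "beta (cor t \<sigma>) = L"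
    by (rule sclosed_unique[of _ _ "int t"])
      (use L maya_beta[OF cor_part(2)] is_core_cor[OF part(1) pos(2)] sim_cor[OF part(1) pos(2)] pos
        in \<open>auto simp: is_core_iff intro: sim_trans sim_sym\<close>)
  have hook_iff: "hook \<longleftrightarrow> (\<exists>x y. x \<in> K \<and> y \<notin> K \<and> L = insert y (K - {x}))"
    using one_rim_hook_iff[OF cor_part] unfolding hook_def K_eq L_eq by blast
  \<comment> \<open>The energy that a configuration of size \<open>k\<close> has after the
    reduction; it may be negative when no such configuration exists.\<close>
  define e where "e k = int k - int s * int (wei s \<tau>) - int t * int (wei t \<sigma>)" for k :: nat
  have eK: "energy K - energy (beta \<tau>) = - int s * int (wei s \<tau>)"
    using psize_cor_wei[OF part(2) pos(1)] energy_beta[OF cor_part(1)] energy_beta[OF part(2)]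
    by (simp add: K_eq)
  have eL: "energy L - energy (beta \<sigma>) = - int t * int (wei t \<sigma>)"
    using psize_cor_wei[OF part(1) pos(2)] energy_beta[OF cor_part(2)] energy_beta[OF part(1)]
    by (simp add: L_eq)
  \<comment> \<open>The numerical conditions say that reduced configurations have
    \<open>s\<close>-weight and \<open>t\<close>-weight 1.\<close>
  have W_iff: "W \<longleftrightarrow> e n = energy L + int s \<and> e n = energy K + int t"
  proof -
    have "W \<longleftrightarrow> int n = int (psize \<sigma> + s * (wei s \<tau> + 1)) \<and>
        int n = int (psize \<tau> + t * (wei t \<sigma> + 1))"
      unfolding W_def of_nat_eq_iff ..
    then show ?thesis
      using eK eL energy_beta[OF part(1)] energy_beta[OF part(2)]
      by (auto simp: e_def algebra_simps)
  qed
  have hP: "h ` A \<in> with_cores (int s) (int t) L K (e k) \<longleftrightarrow> A \<in> beta ` P k" for A k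
    using hPS[of A "int k"] beta_partitions_with_cores[OF pos assms(4,5), of k]
    by (simp add: P_def eK eL e_def)
  have h_inv: "h ` inv h ` A = A" "inv h ` h ` A = A" for A
    using h by (simp_all add: image_f_inv_f bij_is_surj bij_is_inj image_inv_f_f)
  have two: "with_cores (int s) (int t) L K (e k) = {h ` A, h ` B} \<longleftrightarrow> beta ` P k = {A, B}" for A B k
  proof -
    have "X \<in> with_cores (int s) (int t) L K (e k) \<longleftrightarrow> X \<in> (`) h ` beta ` P k" for X
      using hP[of "inv h ` X" k] hP[of _ k] h_inv by (metis imageE imageI)
    then have "with_cores (int s) (int t) L K (e k) = (`) h ` beta ` P k"
      by blast
    moreover have "inj ((`) h)"
      using h_inv(2) by (metis injI)
    ultimately show ?thesis
      using inj_image_eq_iff[of "(`) h" "beta ` P k" "{A, B}"] by simp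
  qed
  have P_part: "is_partition l" if "l \<in> P k" for l k
    using that by (simp add: P_def partitions_with_cores_def)
  have P_inj: "l = m" if "beta l = beta m" "is_partition l" "is_partition m" for l m
    using that by (auto simp: is_partition_def intro: beta_inj)
  have W_hook: "hook" if WP: "W" "P n \<noteq> {}"
  proof -
    obtain l where "l \<in> P n"
      using WP(2) by blast
    then have mem: "h ` beta l \<in> with_cores (int s) (int t) L K (e n)"
      by (simp add: hP)
    have en: "e n = energy L + int s" "e n = energy K + int t"
      using WP(1) unfolding W_iff by auto
    show ?thesis
      unfolding hook_iff
      by (rule weights_one_cases[OF ist(4-6) K(1-3) L(1,2) mem en]) blast
  qed
  have one_two: "sc \<and> hook \<and> W" if lm: "l \<noteq> m" "P n = {l, m}" "m = conjugate l" for l m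
  proof -
    have l: "l \<in> P n" "is_partition l" "is_partition m" and m: "conjugate l \<in> P n"
      using lm P_part[of _ n] by auto
    \<comment> \<open>The cores of \<open>conjugate l\<close> are the conjugates of
      \<open>\<sigma>\<close> and \<open>\<tau>\<close>, and membership in \<open>P n\<close> says
      that they are \<open>\<sigma>\<close> and \<open>\<tau>\<close> again.\<close>
    have sc
      using l m cor_conjugate[OF l(2)] pos unfolding sc_def P_def partitions_with_cores_def by auto
    have ne: "h ` beta l \<noteq> h ` beta m"
      using lm(1) P_inj[OF _ l(2,3)] h_inv(2) by metis
    have *: "with_cores (int s) (int t) L K (e n) = {h ` beta l, h ` beta m}"
      unfolding two by (simp add: lm(2))
    have "e n = energy L + int s"
      by (rule with_cores_two_energy[OF ist(1-3) * ne K(1,2) L(1,2)])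
    \<comment> \<open>The same lemma with the roles of \<open>s\<close> and \<open>t\<close>, and of
      \<open>K\<close> and \<open>L\<close>, exchanged.\<close>
    moreover have "e n = energy K + int t"
      by (rule with_cores_two_energy[OF _ ist(3,2) *[unfolded with_cores_commute[of "int s"]] ne
            L(1,3) K(1,3)])
        (use ist(1) in \<open>simp add: coprime_commute\<close>)
    ultimately have W
      by (simp add: W_iff)
    then show ?thesis
      using \<open>sc\<close> W_hook l by blast
  qed
  have two_one: "\<exists>l m. l \<noteq> m \<and> P n = {l, m} \<and> m = conjugate l" if that': sc hook W
  proof -
    obtain x y where xy: "x \<in> K" "y \<notin> K" "L = insert y (K - {x})"
      using that' unfolding hook_iff by blast
    have en: "e n = energy L + int s" "e n = energy K + int t"
      using that' unfolding W_iff by auto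
    obtain z A B where AB: "with_cores (int s) (int t) L K (e n) = {A, B}"
      "A - B = {z, z + int s + int t}" "B - A = {z + int s, z + int t}"
      using with_cores_weights_one[OF ist(4-6) K(1-3) L(1-3) xy en] .
    define A' B' where "A' = inv h ` A" and "B' = inv h ` B"
    have beta_P: "beta ` P n = {A', B'}"
      using AB(1) unfolding two[symmetric] A'_def B'_def h_inv .
    have inj: "inj (inv h)"
      using h by (simp add: bij_is_surj surj_imp_inj_inv)
    have diff: "A' - B' = {inv h z, inv h (z + int s + int t)}"
      "B' - A' = {inv h (z + int s), inv h (z + int t)}"
      unfolding A'_def B'_def image_set_diff[OF inj, symmetric] AB(2,3) by auto
    have "A' \<in> beta ` P n" "B' \<in> beta ` P n"
      by (simp_all add: beta_P)
    then obtain l m where l: "l \<in> P n" "beta l = A'" and m: "m \<in> P n" "beta m = B'"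
      by (auto elim!: imageE)
    have lm_part: "is_partition l" "is_partition m"
      using l m P_part by auto
    have "A' \<noteq> B'"
      using diff by auto
    then have ne: "l \<noteq> m"
      using l m by auto
    have P: "P n = {l, m}"
    proof -
      have "k = l \<or> k = m" if k: "k \<in> P n" for k
      proof -
        have "beta k \<in> {A', B'}"
          using k unfolding beta_P[symmetric] by (rule imageI)
        then show ?thesis
          using l(2) m(2) P_inj[OF _ P_part[OF k] lm_part(1)] P_inj[OF _ P_part[OF k] lm_part(2)]
          by auto
      qed
      then show ?thesis
        using l m by blast
    qed
    have conj_closed: "conjugate k \<in> P n" if "k \<in> P n" for k
      using partitions_with_cores_conjugate[OF pos] that that' unfolding sc_def P_def by blast
    \<comment> \<open>Conjugation permutes the two members of \<open>P n\<close>. If it fixed one it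
      would fix both, although they differ by an exchange of diagonals whose sums agree by
      \<open>rect\<close>.\<close>
    have "conjugate l \<noteq> l"
    proof
      assume fix_l: "conjugate l = l"
      moreover have "conjugate m \<noteq> l"
        using conjugate_conjugate[OF lm_part(2)] fix_l ne by auto
      then have "conjugate m = m"
        using conj_closed[OF m(1)] P by auto
      ultimately have "reflect A' = A'" "reflect B' = B'"
        using beta_conjugate[OF lm_part(1)] beta_conjugate[OF lm_part(2)] l m by auto
      moreover have "inv h z \<noteq> inv h (z + int s + int t)"
        using inj_eq[OF inj, of z "z + int s + int t"] ist(4,5) by simp
      ultimately show False
        by (rule swapped_rectangle_not_self_reflected[OF _ _ diff rect])
    qed
    then have "m = conjugate l"
      using conj_closed[OF l(1)] P by auto
    then show ?thesis
      using ne P by blast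
  qed
  have min: "n = min_size s t \<sigma> \<tau>" if "W" "P n \<noteq> {}"
  proof -
    have "n \<le> k" if "P k \<noteq> {}" for k
    proof -
      obtain l where "l \<in> P k"
        using \<open>P k \<noteq> {}\<close> by blast
      then have "h ` beta l \<in> with_cores (int s) (int t) L K (e k)"
        by (simp add: hP)
      then have mem: "maya (h ` beta l)" "sim (int s) (h ` beta l) L" "sim (int t) (h ` beta l) K"
        "energy (h ` beta l) = e k"
        by (auto simp: with_cores_def)
      obtain i where i: "e k = energy L + int s * int i"
        using mv_to_core[OF mem(1) L(1) ist(4) mem(2) L(2)] mem(4) by metis
      obtain j where j: "e k = energy K + int t * int j"
        using mv_to_core[OF mem(1) K(1) ist(5) mem(3) K(3)] mem(4) by metis
      have en: "e n = energy L + int s" "e n = energy K + int t"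
        using \<open>W\<close> unfolding W_iff by auto
      have ek: "e n - e k = int n - int k"
        by (simp add: e_def)
      show ?thesis
      proof (rule ccontr)
        assume "\<not> n \<le> k"
        \<comment> \<open>A smaller size would force both weights to be 0, so that
          \<open>energy L = energy K\<close>; with the equations for \<open>e n\<close> this gives
          \<open>s = t\<close>.\<close>
        then have "int s * int i < int s * 1" "int t * int j < int t * 1"
          using i j en ek by auto
        then have "i = 0" "j = 0"
          using pos by (auto simp: mult_less_cancel_left_pos)
        then show False
          using i j en st by simp
      qed
    qed
    then show ?thesis
      unfolding min_size_def P_def[symmetric]
      using that(2) by (intro Least_equality[symmetric]) auto
  qed
  have nonempty: "P (min_size s t \<sigma> \<tau>) \<noteq> {}"
    unfolding P_def min_size_def
    by (rule LeastI_ex[OF partitions_with_cores_nonempty[OF assms(3) pos assms(4,5)]])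
  have "(\<exists>l m. l \<noteq> m \<and> P n = {l, m} \<and> m = conjugate l) \<longleftrightarrow> sc \<and> hook \<and> W"
    using one_two two_one by blast
  \<comment> \<open>Forwards, \<open>two_one\<close> supplies a member of \<open>P n\<close>, so
    \<open>min\<close> applies. Backwards, minimality of \<open>n\<close> supplies the member needed
    for \<open>W_hook\<close>.\<close>
  moreover have "sc \<and> hook \<and> W \<longleftrightarrow> sc \<and> n = min_size s t \<sigma> \<tau> \<and> W"
    using two_one min W_hook nonempty by (metis insert_not_empty)
  ultimately show ?thesis
    unfolding P_def sc_def hook_def W_def by blast
qed

end
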